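(* For every real number $\varepsilon$ with $0<\varepsilon\le 1$, we have $b_\varepsilon\le \frac{1}{2\varepsilon}-\frac{1}{2}$.
   Context: Graphs are finite and simple. For an $n$-vertex graph $G$, a set $X\subseteq V(G)$ is a balanced separator if each component of $G-X$ has at most $2n/3$ vertices; $s(G)$ denotes the minimum size of a balanced separator in $G$. For a class $\mathcal{G}$ of graphs, $s_{\mathcal{G}}:\mathbb{N}\to\mathbb{N}$ is defined by $s_{\mathcal{G}}(n)=\max\{s(G):G\in\mathcal{G},\ |V(G)|\le n\}$. A class of graphs is hereditary if it is closed under taking induced subgraphs. For a graph $G$ and an integer $r\ge 0$, an $r$-shallow minor of $G$ is any graph obtained from a subgraph of $G$ by contracting pairwise vertex-disjoint subgraphs, each of radius at most $r$ (in particular, each connected). The density of a graph $H$ is $|E(H)|/|V(H)|$. Let $\nabla_r(G)$ be the maximum density of an $r$-shallow minor of $G$, and for a class $\mathcal{G}$ of graphs let $\nabla_{\mathcal{G}}:\mathbb{N}\to\mathbb{R}\cup\{\infty\}$ be defined by $\nabla_{\mathcal{G}}(r)=\sup\{\nabla_r(G):G\in\mathcal{G}\}$. For $0<\varepsilon\le 1$, $b_\varepsilon$ denotes the supremum of real numbers $b$ for which every hereditary class $\mathcal{G}$ of graphs such that $s_{\mathcal{G}}(n)=\Theta(n^{1-\varepsilon})$ satisfies $\nabla_{\mathcal{G}}(r)=\Omega(r^b)$. Asymptotic notation is with respect to $n\to\infty$ and $r\to\infty$; the implied constants may depend on the class and on $\varepsilon$. *)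

theory Defs
  imports Complex_Main "HOL-Library.Extended_Real" "HOL-Library.Landau_Symbols"
begin

record 'a ugraph =
  verts :: "'a set"
  edges :: "'a set set"

definition simple_graph :: "'a ugraph \<Rightarrow> bool" where
  "simple_graph G \<longleftrightarrow>
     finite (verts G) \<and> (\<forall>e\<in>edges G. e \<subseteq> verts G \<and> card e = 2)"

definition subgraph :: "'a ugraph \<Rightarrow> 'a ugraph \<Rightarrow> bool" where
  "subgraph H G \<longleftrightarrow> simple_graph H \<and> verts H \<subseteq> verts G \<and> edges H \<subseteq> edges G"

definition induced :: "'a ugraph \<Rightarrow> 'a set \<Rightarrow> 'a ugraph" where
  "induced G X = \<lparr>verts = verts G \<inter> X, edges = {e \<in> edges G. e \<subseteq> X}\<rparr>"

definition graph_iso :: "'a ugraph \<Rightarrow> 'b ugraph \<Rightarrow> bool" where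
  "graph_iso G H \<longleftrightarrow>
     (\<exists>f. bij_betw f (verts G) (verts H) \<and> edges H = (\<lambda>e. f ` e) ` edges G)"

definition adj :: "'a ugraph \<Rightarrow> ('a \<times> 'a) set" where
  "adj G = {(u, v). {u, v} \<in> edges G}"

definition components :: "'a ugraph \<Rightarrow> 'a set set" where
  "components G = verts G // {(u, v). u \<in> verts G \<and> v \<in> verts G \<and> (u, v) \<in> (adj G)\<^sup>*}"

text \<open>Distances and radii take the value \<open>\<infinity>\<close> when there is no connecting walk; in particular a
  graph of finite radius is connected and has a vertex.\<close>

definition gdist :: "'a ugraph \<Rightarrow> 'a \<Rightarrow> 'a \<Rightarrow> enat" where
  "gdist G u v = (INF k\<in>{k. (u, v) \<in> adj G ^^ k}. enat k)"

definition radius :: "'a ugraph \<Rightarrow> enat" where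
  "radius G = (INF c\<in>verts G. SUP v\<in>verts G. gdist G c v)"

definition balanced_separator :: "'a ugraph \<Rightarrow> 'a set \<Rightarrow> bool" where
  "balanced_separator G X \<longleftrightarrow>
     X \<subseteq> verts G \<and>
     (\<forall>C\<in>components (induced G (verts G - X)). real (card C) \<le> 2 * real (card (verts G)) / 3)"

definition sep_number :: "'a ugraph \<Rightarrow> nat" where
  "sep_number G = Min (card ` {X. balanced_separator G X})"

text \<open>The vertices of the contracted graph are vertex sets of the original one: the vertex sets of
  the contracted subgraphs, and a singleton for every vertex outside all of them. Loops and
  parallel edges arising from the contraction disappear.\<close>

definition contract :: "'a ugraph \<Rightarrow> 'a ugraph set \<Rightarrow> 'a set ugraph" where
  "contract S B =
     (let W = verts ` B \<union> {{v} |v. v \<in> verts S - \<Union> (verts ` B)}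
      in \<lparr>verts = W,
          edges = {{X, Y} |X Y. X \<in> W \<and> Y \<in> W \<and> X \<noteq> Y \<and> (\<exists>x\<in>X. \<exists>y\<in>Y. {x, y} \<in> edges S)}\<rparr>)"

definition shallow_minor :: "nat \<Rightarrow> 'a ugraph \<Rightarrow> 'a set ugraph \<Rightarrow> bool" where
  "shallow_minor r G H \<longleftrightarrow>
     (\<exists>S B. subgraph S G \<and>
        (\<forall>b\<in>B. subgraph b S \<and> radius b \<le> enat r) \<and>
        pairwise (\<lambda>b b'. verts b \<inter> verts b' = {}) B \<and>
        H = contract S B)"

text \<open>The graph without vertices gets density \<open>0\<close>.\<close>

definition density :: "'a ugraph \<Rightarrow> real" where
  "density H = real (card (edges H)) / real (card (verts H))"

definition nabla :: "nat \<Rightarrow> 'a ugraph \<Rightarrow> real" where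
  "nabla r G = Max (density ` {H. shallow_minor r G H})"

text \<open>Every finite graph is isomorphic to one with vertices in \<^typ>\<open>nat\<close>, so a class of finite graphs
  is an isomorphism-closed set of such graphs.\<close>

definition graph_class :: "nat ugraph set \<Rightarrow> bool" where
  "graph_class \<G> \<longleftrightarrow>
     (\<forall>G\<in>\<G>. simple_graph G) \<and>
     (\<forall>G\<in>\<G>. \<forall>H. simple_graph H \<and> graph_iso G H \<longrightarrow> H \<in> \<G>)"

definition hereditary :: "nat ugraph set \<Rightarrow> bool" where
  "hereditary \<G> \<longleftrightarrow> (\<forall>G\<in>\<G>. \<forall>X\<subseteq>verts G. induced G X \<in> \<G>)"

text \<open>The supremum of natural numbers below is a maximum, since \<^term>\<open>sep_number G\<close> is at most
  \<^term>\<open>card (verts G)\<close>; it is \<open>0\<close> if there is no graph to consider.\<close>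

definition sep_fun :: "nat ugraph set \<Rightarrow> nat \<Rightarrow> nat" where
  "sep_fun \<G> n = (SUP G\<in>{G \<in> \<G>. card (verts G) \<le> n}. sep_number G)"

definition nabla_fun :: "nat ugraph set \<Rightarrow> nat \<Rightarrow> ereal" where
  "nabla_fun \<G> r = (SUP G\<in>\<G>. ereal (nabla r G))"

text \<open>\<open>f(r) = \<Omega>(r\<^sup>b)\<close> for functions that may take the value \<open>\<infinity>\<close>.\<close>

definition omega_powr :: "(nat \<Rightarrow> ereal) \<Rightarrow> real \<Rightarrow> bool" where
  "omega_powr f b \<longleftrightarrow>
     (\<exists>c>0. \<forall>\<^sub>F r in sequentially. ereal (c * real r powr b) \<le> f r)"

text \<open>The supremum is taken in the extended reals because the set may be empty: for \<open>\<epsilon> = 1\<close> the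
  class of edgeless graphs admits no \<open>b\<close> at all.\<close>

definition b_sup :: "real \<Rightarrow> ereal" where
  "b_sup \<epsilon> =
     (SUP b\<in>{b. \<forall>\<G>. graph_class \<G> \<and> hereditary \<G> \<and>
                    (\<lambda>n. real (sep_fun \<G> n)) \<in> \<Theta>(\<lambda>n. real n powr (1 - \<epsilon>))
                  \<longrightarrow> omega_powr (nabla_fun \<G>) b}. ereal b)"

end

theory Submission
  imports Defs "HOL-Library.Countable" "HOL-Library.FuncSet"
begin

text \<open>Take sparse expanders with \<open>m\<close> vertices (``hubs'') and \<open>48 m\<close> edges, subdivide each edge by \<open>L\<close>
  vertices (a ``route''), where \<open>m\<^sup>\<epsilon> \<le> L\<^sup>1\<^sup>-\<^sup>\<epsilon>\<close>, and close under subgraphs.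

  Separators: the full graph has about \<open>m L\<close> vertices and needs a separator of size \<open>\<Omega>(m)\<close>, which is
  \<open>\<Omega>(n\<^sup>1\<^sup>-\<^sup>\<epsilon>)\<close> for suitable \<open>m\<close> and \<open>L\<close>. Conversely a subgraph with \<open>k\<close> vertices is separated by all of
  its at most \<open>m\<close> hubs, or by at most \<open>k / L\<close> vertices cutting the routes, up to two further vertices;
  and \<open>min m (k / L) \<le> m\<^sup>\<epsilon> (k / L)\<^sup>1\<^sup>-\<^sup>\<epsilon> \<le> k\<^sup>1\<^sup>-\<^sup>\<epsilon>\<close>.

  Minors: for \<open>2 r \<le> L\<close> a branch set contains at most one hub, so the density is bounded by a constant.
  Otherwise, since only \<open>48 m\<close> routes can join branch sets containing hubs, the density is
  \<open>O(\<surd>m)\<close>, and \<open>\<surd>m\<close> is at most \<open>L\<close> to the power \<open>(1 - \<epsilon>) / (2 \<epsilon>)\<close>, where \<open>L < 2 r\<close>.\<close>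

section \<open>Random sparse expanders\<close>

text \<open>\<open>f\<close> encodes a directed multigraph of out-degree 48: \<open>f (i, j)\<close>
  is the head of the \<open>j\<close>-th edge out of \<open>i\<close>. Loops and parallel edges may
  occur; subdividing them leaves a simple graph. One sixth is a size that both sides of the hub
  partition in the separator bound reach.\<close>

definition expanding :: "nat \<Rightarrow> (nat \<times> nat \<Rightarrow> nat) \<Rightarrow> bool" where
  "expanding m f \<longleftrightarrow>
     (\<forall>A\<subseteq>{..<m}. \<forall>B\<subseteq>{..<m}. m \<le> 6 * card A \<longrightarrow> m \<le> 6 * card B \<longrightarrow>
        (\<exists>i\<in>A. \<exists>j<48. f (i, j) \<in> B))"

text \<open>Union bound: for fixed \<open>A\<close> and \<open>B\<close>, a random \<open>f\<close> avoids \<open>B\<close> on \<open>A\<close> with probability at most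
  \<open>(5/6)\<close> to the power \<open>8 m\<close>, there are at most \<open>4\<close> to the power \<open>m\<close> such pairs, and
  \<open>4 * 5 ^ 8 < 6 ^ 8\<close>; the constant \<open>48\<close> is chosen for this last inequality.\<close>

lemma ex_expanding:
  assumes "m \<ge> 1"
  obtains f where "f \<in> {..<m} \<times> {..<48} \<rightarrow> {..<m}" "expanding m f"
proof -
  let ?P = "{..<m} \<times> {..<48::nat}"
  define F where "F = ?P \<rightarrow>\<^sub>E {..<m}"
  \<comment> \<open>The functions without an edge from \<open>A\<close> into \<open>B\<close>,
    written as a product so that \<open>card_PiE\<close> counts them.\<close>
  define avoid where
    "avoid = (\<lambda>A B. \<Pi>\<^sub>E p\<in>?P. if fst p \<in> A then {..<m} - B else {..<m})"
  define I where "I = {(A, B). A \<subseteq> {..<m} \<and> B \<subseteq> {..<m} \<and> m \<le> 6 * card A \<and> m \<le> 6 * card B}"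
  have fin: "finite F" by (auto simp: F_def intro!: finite_PiE)
  have cF: "card F = m ^ (48 * m)" by (simp add: F_def card_PiE mult.commute)
  have I_sub: "I \<subseteq> Pow {..<m} \<times> Pow {..<m}" by (auto simp: I_def)
  have finI: "finite I" by (rule finite_subset[OF I_sub]) auto
  have "card I \<le> card (Pow {..<m} \<times> Pow {..<m})" by (rule card_mono[OF _ I_sub]) auto
  also have "\<dots> = 4 ^ m"
    by (simp add: card_cartesian_product card_Pow flip: power_mult_distrib)
  finally have cI: "card I \<le> 4 ^ m" .
  have bad: "card (avoid A B) * 6 ^ (8 * m) \<le> m ^ (48 * m) * 5 ^ (8 * m)"
    if "(A, B) \<in> I" for A B
  proof -
    from that have AB: "A \<subseteq> {..<m}" "B \<subseteq> {..<m}" "m \<le> 6 * card A" "m \<le> 6 * card B"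
      by (auto simp: I_def)
    have [simp]: "finite A" "finite B" using AB finite_subset by blast+
    have cA: "card A \<le> m" and cB: "card B \<le> m"
      using AB card_mono[of "{..<m}"] by auto
    define a where "a = 48 * card A"
    define c where "c = 48 * (m - card A)"
    have split: "?P = A \<times> {..<48} \<union> ({..<m} - A) \<times> {..<48}" using AB by auto
    have "card (avoid A B) = (\<Prod>p\<in>?P. card (if fst p \<in> A then {..<m} - B else {..<m}))"
      unfolding avoid_def by (rule card_PiE) auto
    also have "\<dots> = (\<Prod>p\<in>A \<times> {..<48::nat}. m - card B) * (\<Prod>p\<in>({..<m} - A) \<times> {..<48::nat}. m)"
    proof -
      have "(\<Prod>p\<in>A \<times> {..<48::nat}. card (if fst p \<in> A then {..<m} - B else {..<m}))
          = (\<Prod>p\<in>A \<times> {..<48::nat}. m - card B)"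
        using AB by (intro prod.cong) (auto simp: card_Diff_subset)
      moreover have
        "(\<Prod>p\<in>({..<m} - A) \<times> {..<48::nat}. card (if fst p \<in> A then {..<m} - B else {..<m}))
          = (\<Prod>p\<in>({..<m} - A) \<times> {..<48::nat}. m)"
        by (intro prod.cong) auto
      ultimately show ?thesis unfolding split by (subst prod.union_disjoint) auto
    qed
    also have "\<dots> = (m - card B) ^ a * m ^ c"
      using AB by (simp add: card_cartesian_product card_Diff_subset a_def c_def mult.commute)
    finally have card_eq: "card (avoid A B) = (m - card B) ^ a * m ^ c" .
    have a_ge: "8 * m \<le> a" using AB by (simp add: a_def)
    have "((m - card B) * 6) ^ a \<le> (m * 5) ^ a"
      using AB by (intro power_mono) auto
    then have h1: "(m - card B) ^ a * 6 ^ a \<le> m ^ a * 5 ^ a"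
      by (simp only: power_mult_distrib)
    \<comment> \<open>Since \<open>A\<close> has at least \<open>m / 6\<close> elements,
      \<open>a\<close> is at least \<open>8 * m\<close>, so (5/6)^a is at most (5/6)^(8 m); stated
      without division.\<close>
    have h2: "(5::nat) ^ a * 6 ^ (8 * m) \<le> 5 ^ (8 * m) * 6 ^ a"
    proof -
      have "(5::nat) ^ (a - 8 * m) \<le> 6 ^ (a - 8 * m)" by (intro power_mono) auto
      then have "5 ^ (8 * m) * 6 ^ (8 * m) * (5::nat) ^ (a - 8 * m)
          \<le> 5 ^ (8 * m) * 6 ^ (8 * m) * 6 ^ (a - 8 * m)" by (rule mult_left_mono) simp
      moreover have "x ^ a = x ^ (8 * m) * x ^ (a - 8 * m)" for x :: nat
        using a_ge by (metis le_add_diff_inverse power_add)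
      ultimately show ?thesis by (simp only: mult_ac)
    qed
    have "6 ^ (8 * m) * ((m - card B) ^ a * 6 ^ a) \<le> 6 ^ (8 * m) * (m ^ a * 5 ^ a)"
      using h1 by (rule mult_left_mono) simp
    also have "\<dots> = m ^ a * (5 ^ a * 6 ^ (8 * m))"
      by (simp only: mult_ac)
    also have "\<dots> \<le> m ^ a * (5 ^ (8 * m) * 6 ^ a)"
      using h2 by (rule mult_left_mono) simp
    finally have "(6 ^ (8 * m) * (m - card B) ^ a) * 6 ^ a \<le> (m ^ a * 5 ^ (8 * m)) * 6 ^ a"
      by (simp only: mult_ac)
    then have "6 ^ (8 * m) * (m - card B) ^ a \<le> m ^ a * 5 ^ (8 * m)"
      by (rule mult_right_le_imp_le) simp
    then have "m ^ c * (6 ^ (8 * m) * (m - card B) ^ a) \<le> m ^ c * (m ^ a * 5 ^ (8 * m))"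
      by (rule mult_left_mono) simp
    also have "m ^ c * (m ^ a * 5 ^ (8 * m)) = m ^ (48 * m) * 5 ^ (8 * m)"
    proof -
      have "c + a = 48 * m" using cA by (simp add: a_def c_def)
      then show ?thesis by (metis mult.assoc power_add)
    qed
    finally show ?thesis by (simp only: card_eq mult_ac)
  qed
  have "\<exists>f\<in>F. \<forall>(A, B)\<in>I. f \<notin> avoid A B"
  proof (rule ccontr)
    assume "\<not> ?thesis"
    then have sub: "F \<subseteq> (\<Union>(A, B)\<in>I. avoid A B)" by (auto simp: case_prod_unfold)
    have "card F \<le> card (\<Union>(A, B)\<in>I. avoid A B)"
      by (rule card_mono[OF _ sub]) (auto simp: avoid_def finI intro!: finite_UN_I finite_PiE)
    also have "\<dots> \<le> (\<Sum>(A, B)\<in>I. card (avoid A B))"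
      using card_UN_le[OF finI, of "\<lambda>(A, B). avoid A B"] by (simp add: case_prod_unfold)
    finally have "card F * 6 ^ (8 * m) \<le> (\<Sum>(A, B)\<in>I. card (avoid A B)) * 6 ^ (8 * m)"
      by (rule mult_right_mono) simp
    also have "\<dots> = (\<Sum>(A, B)\<in>I. card (avoid A B) * 6 ^ (8 * m))"
      by (simp add: sum_distrib_right case_prod_unfold)
    also have "\<dots> \<le> (\<Sum>(A, B)\<in>I. m ^ (48 * m) * 5 ^ (8 * m))"
      using bad by (intro sum_mono) auto
    also have "\<dots> \<le> 4 ^ m * (m ^ (48 * m) * 5 ^ (8 * m))"
      using cI by (simp only: sum_constant case_prod_unfold) simp
    finally have "m ^ (48 * m) * 6 ^ (8 * m) \<le> m ^ (48 * m) * (4 ^ m * 5 ^ (8 * m))"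
      by (simp only: cF mult_ac)
    then have "(6::nat) ^ (8 * m) \<le> 4 ^ m * 5 ^ (8 * m)" using assms by simp
    then have "((6::nat) ^ 8) ^ m \<le> (4 * 5 ^ 8) ^ m"
      by (simp only: power_mult power_mult_distrib)
    \<comment> \<open>The two bases are 6^8 and 4 * 5^8.\<close>
    then have "(1679616::nat) ^ m \<le> 1562500 ^ m" by simp
    moreover have "(1562500::nat) ^ m < 1679616 ^ m"
      using assms by (intro power_strict_mono) auto
    ultimately show False by linarith
  qed
  then obtain f where f: "f \<in> F" "\<And>A B. (A, B) \<in> I \<Longrightarrow> f \<notin> avoid A B" by auto
  have "expanding m f"
    unfolding expanding_def
  proof (intro allI impI, rule ccontr)
    fix A B
    assume AB: "A \<subseteq> {..<m}" "B \<subseteq> {..<m}" "m \<le> 6 * card A" "m \<le> 6 * card B"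
      and "\<not> (\<exists>i\<in>A. \<exists>j<48. f (i, j) \<in> B)"
    then have "f \<in> avoid A B" using f(1) by (auto simp: avoid_def F_def PiE_iff)
    moreover have "(A, B) \<in> I" using AB by (auto simp: I_def)
    ultimately show False using f(2) by blast
  qed
  moreover have "f \<in> ?P \<rightarrow> {..<m}" using f(1) by (auto simp: F_def PiE_def)
  ultimately show ?thesis using that by blast
qed

section \<open>Subdivided expanders\<close>

text \<open>Labels keep the role of each vertex visible. Graph classes live on \<open>nat\<close>,
  and countability of the type carries the graphs over there.\<close>

datatype label = Hub nat | Mid "nat \<times> nat" nat

instance label :: countable
  by countable_datatype

text \<open>Vertices of the route \<open>p = (i, j)\<close>, the \<open>j\<close>-th one starting at hub \<open>i\<close>: position \<open>0\<close> is the hub \<open>i\<close>,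
  position \<open>L + 1\<close> the hub \<open>f p\<close>.\<close>

definition route :: "nat \<Rightarrow> (nat \<times> nat \<Rightarrow> nat) \<Rightarrow> nat \<times> nat \<Rightarrow> nat \<Rightarrow> label" where
  "route L f p t = (if t = 0 then Hub (fst p) else if t \<le> L then Mid p t else Hub (f p))"

lemma route_simps [simp]:
  "route L f p 0 = Hub (fst p)"
  "1 \<le> t \<Longrightarrow> t \<le> L \<Longrightarrow> route L f p t = Mid p t"
  "L < t \<Longrightarrow> route L f p t = Hub (f p)"
  by (auto simp: route_def)

lemma route_eq_Mid [simp]: "route L f p t = Mid q s \<longleftrightarrow> p = q \<and> t = s \<and> 1 \<le> t \<and> t \<le> L"
  by (auto simp: route_def)

text \<open>The degree \<open>d\<close> is a parameter: the upper bounds on separators and densities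
  hold for every \<open>d\<close>, while the lower bound on separators takes \<open>d = 48\<close>
  and an expanding \<open>f\<close>.\<close>

definition subdivision :: "nat \<Rightarrow> nat \<Rightarrow> nat \<Rightarrow> (nat \<times> nat \<Rightarrow> nat) \<Rightarrow> label ugraph" where
  "subdivision d m L f =
     \<lparr>verts = Hub ` {..<m} \<union> (\<lambda>(p, t). Mid p t) ` (({..<m} \<times> {..<d}) \<times> {1..L}),
      edges = {{route L f p t, route L f p (Suc t)} | p t. p \<in> {..<m} \<times> {..<d} \<and> t \<le> L}\<rparr>"

section \<open>Components and separators\<close>

text \<open>For \<open>u\<close> outside \<open>X\<close>, the component of \<open>u\<close> in
  \<open>G - X\<close>, named by a vertex instead of a quotient class so that arguments can follow
  paths from \<open>u\<close>.\<close>

definition comp_of :: "'a ugraph \<Rightarrow> 'a set \<Rightarrow> 'a \<Rightarrow> 'a set" where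
  "comp_of G X u = {v \<in> verts G - X. (u, v) \<in> (adj (induced G (verts G - X)))\<^sup>*}"

lemma adj_induced:
  "adj (induced G Z) = {(u, v). {u, v} \<in> edges G \<and> u \<in> Z \<and> v \<in> Z}"
  by (auto simp: adj_def induced_def)

lemma sym_adj: "sym (adj G)"
  by (auto simp: adj_def sym_def insert_commute)

lemma balanced_separator_iff:
  "balanced_separator G X \<longleftrightarrow>
     X \<subseteq> verts G \<and> (\<forall>u\<in>verts G - X. 3 * card (comp_of G X u) \<le> 2 * card (verts G))"
proof -
  have "components (induced G (verts G - X)) = comp_of G X ` (verts G - X)"
    by (auto simp: components_def quotient_def comp_of_def induced_def image_def)
  moreover have "real c \<le> 2 * real k / 3 \<longleftrightarrow> 3 * c \<le> 2 * k" for c k by linarith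
  ultimately show ?thesis by (simp add: balanced_separator_def)
qed

lemma comp_of_refl: "u \<in> verts G - X \<Longrightarrow> u \<in> comp_of G X u"
  by (simp add: comp_of_def)

lemma comp_of_subset_verts: "comp_of G X u \<subseteq> verts G - X"
  by (auto simp: comp_of_def)

lemma comp_of_step:
  assumes "v \<in> comp_of G X u" "{v, w} \<in> edges G" "w \<in> verts G - X"
  shows "w \<in> comp_of G X u"
  using assms by (auto simp: comp_of_def adj_induced intro: rtrancl_into_rtrancl)

text \<open>Induction along a path from \<open>u\<close>, all of whose vertices lie in the
  component. Later invariants (the current route, the side of a cut, the anchor hub) are shown
  constant on components in this way.\<close>

lemma comp_of_closed:
  assumes "u \<in> Z"
    and "\<And>x y. x \<in> Z \<Longrightarrow> x \<in> comp_of G X u \<Longrightarrow> y \<in> comp_of G X u \<Longrightarrow> {x, y} \<in> edges G \<Longrightarrow> y \<in> Z"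
  shows "comp_of G X u \<subseteq> Z"
proof
  fix v assume v: "v \<in> comp_of G X u"
  then have "(u, v) \<in> (adj (induced G (verts G - X)))\<^sup>*" by (simp add: comp_of_def)
  then show "v \<in> Z"
  proof (induction rule: rtrancl_induct)
    case base
    then show ?case using assms(1) .
  next
    case (step y z)
    then have "y \<in> comp_of G X u" "z \<in> comp_of G X u" "{y, z} \<in> edges G"
      by (auto simp: comp_of_def adj_induced intro: rtrancl_into_rtrancl)
    then show ?case using assms(2) step by blast
  qed
qed

lemma comp_of_eq:
  assumes "v \<in> comp_of G X u" "u \<in> verts G - X"
  shows "comp_of G X v = comp_of G X u"
proof -
  let ?r = "(adj (induced G (verts G - X)))\<^sup>*"
  have uv: "(u, v) \<in> ?r" using assms by (simp add: comp_of_def)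
  then have "(v, u) \<in> ?r" using sym_adj sym_rtrancl by (metis symD)
  with uv show ?thesis unfolding comp_of_def by (blast intro: rtrancl_trans)
qed

lemma comp_of_antimono:
  assumes "X \<subseteq> Y"
  shows "comp_of G Y u \<subseteq> comp_of G X u"
proof -
  have "adj (induced G (verts G - Y)) \<subseteq> adj (induced G (verts G - X))"
    using assms by (auto simp: adj_induced)
  from rtrancl_mono[OF this] show ?thesis using assms by (auto simp: comp_of_def)
qed

lemma sep_number_le:
  assumes "simple_graph G" "balanced_separator G X"
  shows "sep_number G \<le> card X"
  unfolding sep_number_def
proof (rule Min_le)
  have "{X. balanced_separator G X} \<subseteq> Pow (verts G)" by (auto simp: balanced_separator_def)
  then show "finite (card ` {X. balanced_separator G X})"
    using assms by (meson finite_Pow_iff finite_imageI finite_subset simple_graph_def)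
qed (use assms in auto)

lemma balanced_separator_verts: "balanced_separator G (verts G)"
  by (simp add: balanced_separator_iff)

lemma le_sep_number:
  assumes "simple_graph G" "\<And>X. balanced_separator G X \<Longrightarrow> k \<le> card X"
  shows "k \<le> sep_number G"
proof -
  have "{X. balanced_separator G X} \<subseteq> Pow (verts G)" by (auto simp: balanced_separator_def)
  then have "finite (card ` {X. balanced_separator G X})"
    using assms by (meson finite_Pow_iff finite_imageI finite_subset simple_graph_def)
  then show ?thesis
    unfolding sep_number_def using assms(2) balanced_separator_verts by (subst Min_ge_iff) auto
qed

section \<open>Lower bound on separators\<close>

definition relabel :: "('a \<Rightarrow> 'b) \<Rightarrow> 'a ugraph \<Rightarrow> 'b ugraph" where
  "relabel h G = \<lparr>verts = h ` verts G, edges = (`) h ` edges G\<rparr>"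

lemma route_in_verts:
  assumes "p \<in> {..<m} \<times> {..<d}" "t \<le> Suc L" "f \<in> {..<m} \<times> {..<d} \<rightarrow> {..<m}"
  shows "route L f p t \<in> verts (subdivision d m L f)"
  using assms by (auto simp: route_def subdivision_def)

lemma route_Suc_neq: "L \<ge> 1 \<Longrightarrow> t \<le> L \<Longrightarrow> route L f p t \<noteq> route L f p (Suc t)"
  by (auto simp: route_def)

lemma simple_graph_subdivision:
  assumes "L \<ge> 1" "f \<in> {..<m} \<times> {..<d} \<rightarrow> {..<m}"
  shows "simple_graph (subdivision d m L f)"
proof -
  have "finite (verts (subdivision d m L f))" by (simp add: subdivision_def)
  moreover have "e \<subseteq> verts (subdivision d m L f) \<and> card e = 2"
    if "e \<in> edges (subdivision d m L f)" for e
  proof -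
    from that obtain p t where *: "e = {route L f p t, route L f p (Suc t)}"
      "p \<in> {..<m} \<times> {..<d}" "t \<le> L" by (auto simp: subdivision_def)
    then show ?thesis
      using route_in_verts[OF *(2) _ assms(2)] route_Suc_neq[OF assms(1)] by simp
  qed
  ultimately show ?thesis by (simp add: simple_graph_def)
qed

lemma simple_graph_relabel:
  assumes "inj h" "simple_graph G"
  shows "simple_graph (relabel h G)"
proof -
  have "card (h ` e) = card e" for e
    using assms(1) by (metis card_image inj_on_subset subset_UNIV)
  then show ?thesis
    using assms(2) by (auto simp: simple_graph_def relabel_def)
qed

text \<open>Splits the vertices into blocks, a hub with the inner vertices of its outgoing routes.
  All blocks have size \<open>d * L + 1\<close>, which turns vertex counts into hub counts.\<close>

fun source :: "label \<Rightarrow> nat" where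
  "source (Hub i) = i"
| "source (Mid p t) = fst p"

lemma card_sources:
  assumes "S \<subseteq> {..<m}"
  shows "card {l \<in> verts (subdivision d m L f). source l \<in> S} = card S * (d * L + 1)"
proof -
  have fin: "finite S" using assms finite_subset by blast
  have "{l \<in> verts (subdivision d m L f). source l \<in> S} =
      Hub ` S \<union> (\<lambda>(p, t). Mid p t) ` ((S \<times> {..<d}) \<times> {1..L})"
    using assms by (force simp: subdivision_def image_def)
  also have "card \<dots> = card (Hub ` S) + card ((\<lambda>(p, t). Mid p t) ` ((S \<times> {..<d}) \<times> {1..L}))"
    using fin by (intro card_Un_disjoint) auto
  also have "card (Hub ` S) = card S" by (simp add: card_image inj_on_def)
  also have "card ((\<lambda>(p, t). Mid p t) ` ((S \<times> {..<d}) \<times> {1..L})) = card S * d * L"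
    by (subst card_image) (auto simp: inj_on_def card_cartesian_product)
  finally show ?thesis by (simp add: algebra_simps)
qed

lemma source_less: "l \<in> verts (subdivision d m L f) \<Longrightarrow> source l < m"
  by (auto simp: subdivision_def)

lemma card_verts_subdivision: "card (verts (subdivision d m L f)) = m * (d * L + 1)"
proof -
  have "{l \<in> verts (subdivision d m L f). source l \<in> {..<m}} = verts (subdivision d m L f)"
    using source_less by auto
  then show ?thesis using card_sources[of "{..<m}" m d L f] by simp
qed

text \<open>Hubs with an untouched block (the hub and all inner vertices of its outgoing routes) are
  spread over the components proportionally to the component sizes; blocks all have the same size,
  so a component contains at most two thirds of them.\<close>

lemma balanced_separator_expanding:
  fixes h :: "label \<Rightarrow> 'a"
  assumes h: "inj h" and L: "L \<ge> 1" and f: "f \<in> {..<m} \<times> {..<48} \<rightarrow> {..<m}"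
    and ex: "expanding m f"
    and sep: "balanced_separator (relabel h (subdivision 48 m L f)) X"
  shows "m \<le> 12 * card X"
proof (rule ccontr)
  assume "\<not> m \<le> 12 * card X"
  then have small: "12 * card X < m" by simp
  let ?S = "subdivision 48 m L f"
  let ?G = "relabel h ?S"
  let ?C = "comp_of ?G X"
  have finG: "finite (verts ?G)"
    using simple_graph_relabel[OF h simple_graph_subdivision[OF L f]] by (simp add: simple_graph_def)
  have XV: "X \<subseteq> verts ?G" using sep by (simp add: balanced_separator_iff)
  then have finX: "finite X" using finG finite_subset by blast
  \<comment> \<open>The hubs whose block meets \<open>X\<close>, at most one per vertex of
    \<open>X\<close>; \<open>U\<close> collects the hubs with untouched blocks.\<close>
  define M where "M = (source \<circ> inv h) ` X"
  define U where "U = {..<m} - M"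
  have "card M \<le> card X" unfolding M_def using finX by (rule card_image_le)
  moreover have "M \<subseteq> {..<m}"
    using XV source_less h by (fastforce simp: M_def relabel_def)
  ultimately have cU: "card U + card X \<ge> m"
    using finX by (simp add: U_def card_Diff_subset finite_subset[of M "{..<m}"])
  have finU: "finite U" by (simp add: U_def)
  have intact: "h l \<in> verts ?G - X" if "l \<in> verts ?S" "source l \<in> U" for l
    using that h by (force simp: U_def M_def relabel_def)
  \<comment> \<open>Up to position \<open>L\<close> the route stays in the untouched block of
    \<open>i\<close>, hence avoids \<open>X\<close>; only position \<open>L + 1\<close> lies in
    another block, which must be untouched as well.\<close>
  have reach: "h (route L f (i, j) t) \<in> ?C (h (Hub i))"
    if i: "i \<in> U" and j: "j < 48" and t: "t \<le> Suc L" "t = Suc L \<Longrightarrow> f (i, j) \<in> U" for i j t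
    using t
  proof (induction t)
    case 0
    have "Hub i \<in> verts ?S" using i by (simp add: subdivision_def U_def)
    then have "h (Hub i) \<in> verts ?G - X" using i by (intro intact) auto
    then show ?case by (simp add: comp_of_refl)
  next
    case (Suc t)
    have p: "(i, j) \<in> {..<m} \<times> {..<48}" using i j by (simp add: U_def)
    have "h (route L f (i, j) t) \<in> ?C (h (Hub i))" using Suc by simp
    moreover have "{h (route L f (i, j) t), h (route L f (i, j) (Suc t))} \<in> edges ?G"
      using p Suc.prems unfolding relabel_def subdivision_def
      by (auto intro!: image_eqI[where x = "{route L f (i, j) t, route L f (i, j) (Suc t)}"])
    moreover have "h (route L f (i, j) (Suc t)) \<in> verts ?G - X"
    proof (rule intact)
      show "route L f (i, j) (Suc t) \<in> verts ?S" using p Suc.prems f by (intro route_in_verts) auto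
      show "source (route L f (i, j) (Suc t)) \<in> U" using Suc.prems i by (auto simp: route_def)
    qed
    ultimately show ?case by (rule comp_of_step)
  qed
  have hub: "h (Hub i) \<in> verts ?G - X" if "i \<in> U" for i
    using that by (intro intact) (auto simp: subdivision_def U_def)
  have class_le: "3 * card {i' \<in> U. ?C (h (Hub i')) = ?C (h (Hub i))} \<le> 2 * m" if "i \<in> U" for i
  proof -
    let ?A = "{i' \<in> U. ?C (h (Hub i')) = ?C (h (Hub i))}"
    let ?B = "{l \<in> verts ?S. source l \<in> ?A}"
    have "h ` ?B \<subseteq> ?C (h (Hub i))"
    proof clarify
      fix l assume l: "l \<in> verts ?S" "source l \<in> U"
        and eq: "?C (h (Hub (source l))) = ?C (h (Hub i))"
      show "h l \<in> ?C (h (Hub i))"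
      proof (cases l)
        case (Hub i')
        then have "h l \<in> ?C (h (Hub (source l)))" using comp_of_refl[OF hub[OF l(2)]] by simp
        then show ?thesis using eq by simp
      next
        case (Mid p t)
        then have "1 \<le> t" "t \<le> L" "snd p < 48" using l by (auto simp: subdivision_def)
        then have "h (route L f (fst p, snd p) t) \<in> ?C (h (Hub (fst p)))"
          using l Mid by (intro reach) auto
        moreover have "route L f (fst p, snd p) t = l"
          using Mid \<open>1 \<le> t\<close> \<open>t \<le> L\<close> by simp
        ultimately show ?thesis using eq Mid by simp
      qed
    qed
    then have "card (h ` ?B) \<le> card (?C (h (Hub i)))"
      using finG comp_of_subset_verts[of ?G X] by (meson card_mono finite_Diff finite_subset)
    moreover have "card (h ` ?B) = card ?A * (48 * L + 1)"
      using card_sources[of ?A m 48 L f] card_image[OF inj_on_subset[OF h], of ?B]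
      by (auto simp: U_def)
    moreover have "3 * card (?C (h (Hub i))) \<le> 2 * card (verts ?G)"
      using sep hub[OF that] by (simp add: balanced_separator_iff)
    moreover have "card (verts ?G) = m * (48 * L + 1)"
      using card_image[OF inj_on_subset[OF h]] card_verts_subdivision by (simp add: relabel_def)
    ultimately have "3 * card ?A * (48 * L + 1) \<le> 2 * m * (48 * L + 1)" by simp
    then show ?thesis by (simp only: mult_le_cancel2)
  qed
  \<comment> \<open>Unions of classes of hubs sharing a component, with at most two thirds of all
    hubs. A largest such union \<open>A\<close> will be one side of the partition.\<close>
  define closed where "closed = (\<lambda>A. A \<subseteq> U \<and>
    (\<forall>i\<in>A. \<forall>i'\<in>U. ?C (h (Hub i')) = ?C (h (Hub i)) \<longrightarrow> i' \<in> A) \<and> 3 * card A \<le> 2 * m)"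
  have "closed {}" by (simp add: closed_def)
  moreover have "\<forall>A. closed A \<longrightarrow> card A < Suc (card U)"
    using finU by (auto simp: closed_def less_Suc_eq_le intro: card_mono)
  ultimately obtain A where A: "closed A" "\<And>A'. closed A' \<Longrightarrow> card A' \<le> card A"
    using ex_has_greatest_nat[of closed "{}" card "Suc (card U)"] by blast
  have AU: "A \<subseteq> U" and cA: "3 * card A \<le> 2 * m"
    and A_closed: "\<And>i i'. i \<in> A \<Longrightarrow> i' \<in> U \<Longrightarrow> ?C (h (Hub i')) = ?C (h (Hub i)) \<Longrightarrow> i' \<in> A"
    using A(1) by (auto simp: closed_def)
  have finA: "finite A" using AU finU finite_subset by blast
  have cB: "card (U - A) = card U - card A" using AU finA by (simp add: card_Diff_subset)
  \<comment> \<open>Otherwise some class lies outside \<open>A\<close>. By maximality it is no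
    larger than \<open>A\<close>, so adding it gives fewer than \<open>m / 3\<close> hubs and a
    larger admissible union.\<close>
  have "m \<le> 6 * card A"
  proof (rule ccontr)
    assume "\<not> ?thesis"
    then have lt: "6 * card A < m" by simp
    then have "card (U - A) > 0" using cB cU small by linarith
    then obtain i where i: "i \<in> U" "i \<notin> A" by (metis DiffE card_gt_0_iff ex_in_conv)
    let ?A = "{i' \<in> U. ?C (h (Hub i')) = ?C (h (Hub i))}"
    have "closed ?A" using class_le[OF i(1)] by (auto simp: closed_def)
    then have le: "card ?A \<le> card A" by (rule A(2))
    have "A \<inter> ?A = {}" using A_closed i by fastforce
    then have "card (A \<union> ?A) = card A + card ?A"
      using finA finU by (intro card_Un_disjoint) auto
    moreover have "card ?A > 0" using i finU by (auto simp: card_gt_0_iff)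
    moreover have "closed (A \<union> ?A)"
      using AU A_closed le lt \<open>card (A \<union> ?A) = _\<close> unfolding closed_def by auto
    ultimately show False using A(2)[of "A \<union> ?A"] by simp
  qed
  \<comment> \<open>More than \<open>11 m / 12\<close> hubs are untouched and at most
    \<open>2 m / 3\<close> are in \<open>A\<close>, which leaves over \<open>m / 4\<close>.\<close>
  moreover have "m \<le> 6 * card (U - A)" using cB cU small cA by linarith
  moreover have "A \<subseteq> {..<m}" "U - A \<subseteq> {..<m}" using AU by (auto simp: U_def)
  \<comment> \<open>Expansion gives a route from \<open>A\<close> to \<open>U - A\<close>; it joins
    two untouched hubs, so they share a component, although \<open>A\<close> is a union of
    classes.\<close>
  ultimately obtain i j where ij: "i \<in> A" "j < 48" "f (i, j) \<in> U - A"
    using ex unfolding expanding_def by meson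
  have "h (Hub (f (i, j))) \<in> ?C (h (Hub i))" using reach[of i j "Suc L"] ij AU by auto
  then have "?C (h (Hub (f (i, j)))) = ?C (h (Hub i))" using ij AU by (intro comp_of_eq hub) auto
  then show False using A_closed[of i "f (i, j)"] ij by simp
qed

section \<open>Upper bound on separators\<close>

text \<open>Distinct components are disjoint, and two of them above two thirds would have more
  vertices than \<open>G\<close>.\<close>

lemma card_comp_of_big_unique:
  assumes "simple_graph G" "u \<in> verts G - X" "w \<in> verts G - X"
    and "2 * card (verts G) < 3 * card (comp_of G X u)"
    and "2 * card (verts G) < 3 * card (comp_of G X w)"
  shows "w \<in> comp_of G X u"
proof (rule ccontr)
  assume w: "w \<notin> comp_of G X u"
  have fin: "finite (verts G)" using assms(1) by (simp add: simple_graph_def)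
  have sub: "comp_of G X u \<subseteq> verts G" "comp_of G X w \<subseteq> verts G"
    using comp_of_subset_verts by fastforce+
  have "comp_of G X u \<inter> comp_of G X w = {}"
  proof (rule ccontr)
    assume "\<not> ?thesis"
    then obtain v where "v \<in> comp_of G X u" "v \<in> comp_of G X w" by blast
    then have "comp_of G X u = comp_of G X w" using comp_of_eq assms(2,3) by metis
    then show False using w comp_of_refl[OF assms(3)] by simp
  qed
  then have "card (comp_of G X u) + card (comp_of G X w) = card (comp_of G X u \<union> comp_of G X w)"
    using sub fin by (intro card_Un_disjoint[symmetric]) (auto intro: finite_subset)
  also have "\<dots> \<le> card (verts G)" using sub fin by (intro card_mono) auto
  finally show False using assms(4,5) by linarith
qed

text \<open>Enlarging a separator only shrinks components, and at most one component was too big, so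
  it suffices to inspect the pieces of that one.\<close>

lemma balanced_separator_refine:
  assumes "simple_graph G" "X \<subseteq> X'" "X' \<subseteq> verts G" "u \<in> verts G - X"
    and "2 * card (verts G) < 3 * card (comp_of G X u)"
    and "\<And>w. w \<in> comp_of G X u - X' \<Longrightarrow> 3 * card (comp_of G X' w) \<le> 2 * card (verts G)"
  shows "balanced_separator G X'"
  unfolding balanced_separator_iff
proof (intro conjI ballI assms(3), rule ccontr)
  fix w assume w: "w \<in> verts G - X'" and big: "\<not> 3 * card (comp_of G X' w) \<le> 2 * card (verts G)"
  have "finite (comp_of G X w)"
    using assms(1) comp_of_subset_verts by (metis finite_Diff finite_subset simple_graph_def)
  then have "card (comp_of G X' w) \<le> card (comp_of G X w)"
    using comp_of_antimono[OF assms(2)] by (rule card_mono)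
  then have "w \<in> comp_of G X u"
    using assms(2) w big by (intro card_comp_of_big_unique assms) auto
  then show False using assms(6) w big by simp
qed

text \<open>Inner positions start at 1 and all hubs, also as ends of routes, get 0; thus a level
  \<open>s \<ge> 1\<close> contains no hub.\<close>

fun position :: "label \<Rightarrow> nat" where
  "position (Hub i) = 0"
| "position (Mid p t) = t"

text \<open>Through \<open>g\<close> the graph is a copy of a subgraph of a subdivision, so that
  routes and positions serve as coordinates on it.\<close>

locale labelled =
  fixes G :: "'a ugraph" and g :: "'a \<Rightarrow> label" and d m L :: nat and f :: "nat \<times> nat \<Rightarrow> nat"
  assumes simple: "simple_graph G"
    and L_pos: "L \<ge> 1"
    and inj_label: "inj_on g (verts G)"
    and label_verts: "g ` verts G \<subseteq> verts (subdivision d m L f)"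
    and label_edges: "\<And>u v. {u, v} \<in> edges G \<Longrightarrow> {g u, g v} \<in> edges (subdivision d m L f)"
begin

lemma finite_verts: "finite (verts G)"
  using simple by (simp add: simple_graph_def)

lemma edge_verts: "{u, v} \<in> edges G \<Longrightarrow> u \<in> verts G \<and> v \<in> verts G"
  using simple by (auto simp: simple_graph_def)

lemma edgeE:
  assumes "{u, v} \<in> edges G"
  obtains p t where "p \<in> {..<m} \<times> {..<d}" "t \<le> L"
    "g u = route L f p t \<and> g v = route L f p (Suc t) \<or> g v = route L f p t \<and> g u = route L f p (Suc t)"
proof -
  obtain p t where "p \<in> {..<m} \<times> {..<d}" "t \<le> L"
    "{g u, g v} = {route L f p t, route L f p (Suc t)}"
    using label_edges[OF assms] by (auto simp: subdivision_def)
  then show ?thesis using that by (metis doubleton_eq_iff)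
qed

lemma Mid_range: "v \<in> verts G \<Longrightarrow> g v = Mid p t \<Longrightarrow> 1 \<le> t \<and> t \<le> L"
  using label_verts by (fastforce simp: subdivision_def image_iff subset_iff)

lemma Mid_neighbour:
  assumes "{u, v} \<in> edges G" "g u = Mid p t"
  shows "g v = route L f p (t - 1) \<or> g v = route L f p (Suc t)"
  using assms(1)
proof (cases rule: edgeE)
  case (1 q s)
  then show ?thesis using assms(2) by (metis diff_Suc_1 route_eq_Mid)
qed

text \<open>Neighbours of an inner vertex lie on its own route, and changing the route requires
  passing a hub.\<close>

lemma comp_of_same_route:
  assumes "u \<in> verts G - X" "\<And>v i. v \<in> comp_of G X u \<Longrightarrow> g v \<noteq> Hub i"
  shows "\<exists>p. \<forall>v\<in>comp_of G X u. \<exists>t. g v = Mid p t"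
proof -
  obtain p t where pt: "g u = Mid p t"
    using assms comp_of_refl by (metis label.exhaust)
  have "comp_of G X u \<subseteq> {v. \<exists>t. g v = Mid p t}"
  proof (rule comp_of_closed)
    fix x y assume xy: "x \<in> {v. \<exists>t. g v = Mid p t}" "y \<in> comp_of G X u" "{x, y} \<in> edges G"
    then obtain t where "g y = route L f p t" using Mid_neighbour by blast
    then show "y \<in> {v. \<exists>t. g v = Mid p t}" using assms(2)[OF xy(2)] by (auto simp: route_def split: if_splits)
  qed (use pt in auto)
  then show ?thesis by blast
qed

text \<open>A component that is too big and has no hub lies on a single route, where one well-placed
  vertex splits it into balanced pieces.\<close>

lemma split_route:
  assumes X: "X \<subseteq> verts G"
    and big: "\<And>u. u \<in> verts G - X \<Longrightarrow> 2 * card (verts G) < 3 * card (comp_of G X u) \<Longrightarrow>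
      (\<And>v i. v \<in> comp_of G X u \<Longrightarrow> g v \<noteq> Hub i)"
  shows "sep_number G \<le> card X + 1"
proof (cases "balanced_separator G X")
  case True
  then show ?thesis using sep_number_le[OF simple] by fastforce
next
  case False
  then obtain u where u: "u \<in> verts G - X" "2 * card (verts G) < 3 * card (comp_of G X u)"
    using X by (auto simp: balanced_separator_iff not_le)
  define Q where "Q = comp_of G X u"
  have QV: "Q \<subseteq> verts G - X" using comp_of_subset_verts by (simp add: Q_def)
  have finQ: "finite Q" using QV finite_verts by (meson finite_Diff finite_subset)
  obtain p where p: "\<And>v. v \<in> Q \<Longrightarrow> g v = Mid p (position (g v))"
    using comp_of_same_route[OF u(1) big[OF u]] unfolding Q_def by fastforce
  define below where "below = (\<lambda>t. {v \<in> Q. position (g v) \<le> t})"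
  have pos: "1 \<le> position (g v) \<and> position (g v) \<le> L" if "v \<in> Q" for v
    using p[OF that] Mid_range that QV by blast
  have "below L = Q" using pos by (auto simp: below_def)
  then have ex: "card (verts G) \<le> 3 * card (below L)" using u by (simp add: Q_def)
  \<comment> \<open>Less than a third of the vertices of \<open>G\<close> lie in \<open>Q\<close>
    before this position, and at most two thirds after it. Deleting the vertex at \<open>T\<close>
    therefore balances \<open>Q\<close>.\<close>
  define T where "T = (LEAST t. card (verts G) \<le> 3 * card (below t))"
  have T: "card (verts G) \<le> 3 * card (below T)" unfolding T_def using ex by (rule LeastI)
  have less_T: "3 * card (below t) < card (verts G)" if "t < T" for t
    using that not_less_Least unfolding T_def by (metis not_le)
  have "card (verts G) > 0" using u(1) finite_verts by (auto simp: card_gt_0_iff)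
  moreover have "below 0 = {}" using pos by (fastforce simp: below_def)
  ultimately have "T > 0" using T by (cases T) auto
  have "below T \<noteq> below (T - 1)" using T less_T[of "T - 1"] \<open>T > 0\<close> by auto
  then obtain v where v: "v \<in> Q" "position (g v) = T" by (force simp: below_def)
  have uniq: "w = v" if "w \<in> Q" "position (g w) = T" for w
    using p[OF that(1)] p[OF v(1)] that v inj_label QV by (metis DiffE inj_onD subsetD)
  define X' where "X' = insert v X"
  have "balanced_separator G X'"
  proof (rule balanced_separator_refine[OF simple _ _ u])
    show XX': "X \<subseteq> X'" unfolding X'_def by (rule subset_insertI)
    show "X' \<subseteq> verts G" using X v QV by (auto simp: X'_def)
    fix w assume w: "w \<in> comp_of G X u - X'"
    let ?C = "comp_of G X' w"
    have "?C \<subseteq> comp_of G X w" using XX' by (rule comp_of_antimono)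
    also have "comp_of G X w = Q" unfolding Q_def using w u(1) by (intro comp_of_eq) auto
    finally have CQ: "?C \<subseteq> Q - {v}" using comp_of_subset_verts[of G X' w] by (auto simp: X'_def)
    have step: "position (g y) < T \<longleftrightarrow> position (g x) < T"
      if "x \<in> ?C" "y \<in> ?C" "{x, y} \<in> edges G" for x y
    proof -
      have xy: "x \<in> Q" "y \<in> Q" "position (g x) \<noteq> T" "position (g y) \<noteq> T"
        using that CQ uniq by blast+
      have "g y = route L f p (position (g x) - 1) \<or> g y = route L f p (Suc (position (g x)))"
        using Mid_neighbour[OF that(3) p[OF xy(1)]] .
      then have "position (g y) = position (g x) - 1 \<or> position (g y) = Suc (position (g x))"
        using p[OF xy(2)] by (metis route_eq_Mid)
      then show ?thesis using xy pos[OF xy(1)] by auto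
    qed
    show "3 * card ?C \<le> 2 * card (verts G)"
    proof (cases "position (g w) < T")
      case True
      have "?C \<subseteq> {x. position (g x) < T}" using step True by (intro comp_of_closed) auto
      then have "?C \<subseteq> below (T - 1)" using CQ by (auto simp: below_def)
      then have "card ?C \<le> card (below (T - 1))" using finQ by (intro card_mono) (auto simp: below_def)
      then show ?thesis using less_T[of "T - 1"] \<open>T > 0\<close> by simp
    next
      case False
      have "?C \<subseteq> {x. \<not> position (g x) < T}" using step False by (intro comp_of_closed) auto
      then have "?C \<subseteq> Q - below T" using CQ uniq by (fastforce simp: below_def)
      then have "card ?C \<le> card (Q - below T)" using finQ by (intro card_mono) auto
      also have "\<dots> = card Q - card (below T)"
        using finQ by (intro card_Diff_subset) (auto simp: below_def)
      finally have "card ?C \<le> card Q - card (below T)" .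
      moreover have "card Q \<le> card (verts G)" using QV by (intro card_mono finite_verts) auto
      ultimately show ?thesis using T by arith
    qed
  qed
  moreover have "card X' \<le> card X + 1" unfolding X'_def using X finite_verts
    by (simp add: card_insert_if finite_subset)
  ultimately show ?thesis using sep_number_le[OF simple] by fastforce
qed

text \<open>Deleting all hubs leaves hub-free components; the extra vertex comes from
  \<open>split_route\<close>.\<close>

lemma sep_number_le_hubs: "sep_number G \<le> m + 1"
proof -
  define X where "X = {v \<in> verts G. \<exists>i. g v = Hub i}"
  have "sep_number G \<le> card X + 1"
    using comp_of_subset_verts[of G X] by (intro split_route) (auto simp: X_def)
  moreover have "card X = card (g ` X)"
    using inj_label by (intro card_image[symmetric]) (auto simp: X_def inj_on_def)
  moreover have "card (g ` X) \<le> card (Hub ` {..<m})"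
    using label_verts by (intro card_mono) (auto simp: X_def subdivision_def)
  moreover have "card (Hub ` {..<m}) \<le> m" using card_image_le[of "{..<m}" Hub] by simp
  ultimately show ?thesis by linarith
qed

text \<open>Cutting every route at the same position \<open>s\<close> leaves components with at most one hub each;
  by averaging, some \<open>s\<close> is hit by at most an \<open>L\<close>-th of the vertices.\<close>

lemma sep_number_le_levels: "\<exists>c. c * L \<le> card (verts G) \<and> sep_number G \<le> c + 2"
proof -
  define level where "level = (\<lambda>s. {v \<in> verts G. position (g v) = s})"
  have "\<exists>s\<in>{1..L}. card (level s) * L \<le> card (verts G)"
  proof (rule ccontr)
    assume "\<not> ?thesis"
    then have gt: "card (verts G) < card (level s) * L" if "s \<in> {1..L}" for s
      using that by (meson not_le)
    have "L * card (verts G) = (\<Sum>s\<in>{1..L}. card (verts G))" by simp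
    also have "\<dots> < (\<Sum>s\<in>{1..L}. card (level s) * L)"
      using L_pos gt by (intro sum_strict_mono) auto
    also have "\<dots> = card (\<Union>s\<in>{1..L}. level s) * L"
      using finite_verts
      by (subst card_UN_disjoint) (auto simp: level_def sum_distrib_right)
    also have "\<dots> \<le> card (verts G) * L"
      using finite_verts by (intro mult_right_mono card_mono) (auto simp: level_def)
    finally show False by (simp add: mult.commute)
  qed
  then obtain s where s: "1 \<le> s" "s \<le> L" "card (level s) * L \<le> card (verts G)" by auto
  define X where "X = level s"
  have XV: "X \<subseteq> verts G" by (auto simp: X_def level_def)
  \<comment> \<open>The only hub that a vertex can still reach once level \<open>s\<close> is
    deleted: the start of its route before the cut, the end after it.\<close>
  define anchor where
    "anchor = (\<lambda>l. case l of Hub i \<Rightarrow> i | Mid p t \<Rightarrow> if t < s then fst p else f p)"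
  have anchor: "anchor (g y) = anchor (g x)"
    if "x \<in> comp_of G X u" "y \<in> comp_of G X u" "{x, y} \<in> edges G" for x y u
  proof -
    have "x \<notin> X" "y \<notin> X" using that comp_of_subset_verts by fastforce+
    then have ne: "position (g x) \<noteq> s" "position (g y) \<noteq> s"
      using edge_verts[OF that(3)] by (auto simp: X_def level_def)
    have *: "anchor (route L f p t) = anchor (route L f p (Suc t))"
      if "t \<le> L" "position (route L f p t) \<noteq> s" "position (route L f p (Suc t)) \<noteq> s" for p t
      using that s by (auto simp: anchor_def route_def split: if_splits)
    show ?thesis using that(3) by (cases rule: edgeE) (use * ne in metis)
  qed
  have same: "x = y" if "x \<in> comp_of G X u" "y \<in> comp_of G X u" "g x = Hub i" "g y = Hub j" "u \<in> verts G - X"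
    for x y u i j
  proof -
    have "comp_of G X u \<subseteq> {v. anchor (g v) = anchor (g u)}"
      using anchor by (intro comp_of_closed) auto
    then have "anchor (g x) = anchor (g u)" "anchor (g y) = anchor (g u)" using that by blast+
    then have "g x = g y" using that by (simp add: anchor_def)
    then show ?thesis using inj_label that(1,2) comp_of_subset_verts by (metis DiffE inj_onD subsetD)
  qed
  have "sep_number G \<le> card X + 2"
  proof (cases "\<exists>u b i. u \<in> verts G - X \<and> 2 * card (verts G) < 3 * card (comp_of G X u)
      \<and> b \<in> comp_of G X u \<and> g b = Hub i")
    case False
    then have "sep_number G \<le> card X + 1" by (intro split_route XV) blast
    then show ?thesis by simp
  next
    case True
    then obtain u b i where u: "u \<in> verts G - X" "2 * card (verts G) < 3 * card (comp_of G X u)"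
      and b: "b \<in> comp_of G X u" "g b = Hub i" by blast
    \<comment> \<open>Deleting the only hub \<open>b\<close> of the big component makes that
      component hub-free. One vertex for \<open>b\<close> and one from \<open>split_route\<close>
      give the \<open>+ 2\<close>.\<close>
    define X' where "X' = insert b X"
    have "sep_number G \<le> card X' + 1"
    proof (rule split_route)
      show "X' \<subseteq> verts G" using XV b comp_of_subset_verts by (fastforce simp: X'_def)
      fix w v j
      assume w: "w \<in> verts G - X'" "2 * card (verts G) < 3 * card (comp_of G X' w)"
        and v: "v \<in> comp_of G X' w"
      have sub: "comp_of G X' w \<subseteq> comp_of G X w" by (rule comp_of_antimono) (auto simp: X'_def)
      have "finite (comp_of G X w)"
        using finite_verts comp_of_subset_verts by (metis finite_Diff finite_subset)
      from card_mono[OF this sub] have "w \<in> comp_of G X u"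
        using u w by (intro card_comp_of_big_unique[OF simple]) (auto simp: X'_def)
      then have "comp_of G X w = comp_of G X u" using u(1) by (rule comp_of_eq)
      then have "v \<in> comp_of G X u" using v sub by auto
      moreover have "v \<noteq> b" using v comp_of_subset_verts[of G X' w] by (auto simp: X'_def)
      ultimately show "g v \<noteq> Hub j" using same b u(1) by blast
    qed
    moreover have "card X' \<le> card X + 1" unfolding X'_def using XV finite_verts
      by (simp add: card_insert_if finite_subset)
    ultimately show ?thesis by simp
  qed
  then show ?thesis using s(3) unfolding X_def by blast
qed

end

section \<open>Density of shallow minors\<close>

text \<open>Connectedness of the subgraph induced on \<open>X\<close>, in the form in which it is
  applied: a set that meets \<open>X\<close> and is closed under the edges inside \<open>X\<close>
  swallows \<open>X\<close>.\<close>

definition cut_connected :: "'a ugraph \<Rightarrow> 'a set \<Rightarrow> bool" where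
  "cut_connected G X \<longleftrightarrow> X \<noteq> {} \<and>
     (\<forall>Z. Z \<inter> X \<noteq> {} \<longrightarrow> (\<forall>x\<in>X \<inter> Z. \<forall>y\<in>X. {x, y} \<in> edges G \<longrightarrow> y \<in> Z) \<longrightarrow> X \<subseteq> Z)"

lemma cut_connectedD:
  assumes "cut_connected G X" "z \<in> X" "z \<in> Z"
    and "\<And>x y. x \<in> X \<Longrightarrow> x \<in> Z \<Longrightarrow> y \<in> X \<Longrightarrow> {x, y} \<in> edges G \<Longrightarrow> y \<in> Z"
  shows "X \<subseteq> Z"
proof -
  have "Z \<inter> X \<noteq> {}" using assms(2,3) by blast
  moreover have "\<forall>x\<in>X \<inter> Z. \<forall>y\<in>X. {x, y} \<in> edges G \<longrightarrow> y \<in> Z" using assms(4) by blast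
  ultimately show ?thesis using assms(1) by (simp add: cut_connected_def)
qed

text \<open>The centre lies in \<open>X\<close> but walks may use all of \<open>G\<close>, so the
  property passes from a contracted subgraph to the whole graph.\<close>

definition within_radius :: "nat \<Rightarrow> 'a ugraph \<Rightarrow> 'a set \<Rightarrow> bool" where
  "within_radius r G X \<longleftrightarrow> (\<exists>c\<in>X. \<forall>v\<in>X. \<exists>k\<le>r. (c, v) \<in> adj G ^^ k)"

lemma radius_le_enat:
  assumes "radius b \<le> enat r"
  shows "within_radius r b (verts b)"
proof -
  \<comment> \<open>A strict bound on an infimum yields a witness; hence the passage from
    \<open>r\<close> to \<open>Suc r\<close>.\<close>
  have "radius b < enat (Suc r)" using assms by (meson enat_ord_simps(2) lessI order_le_less_trans)
  then obtain c where c: "c \<in> verts b" "(SUP v\<in>verts b. gdist b c v) < enat (Suc r)"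
    by (auto simp: radius_def INF_less_iff)
  have "\<exists>k\<le>r. (c, v) \<in> adj b ^^ k" if "v \<in> verts b" for v
  proof -
    have "gdist b c v < enat (Suc r)" using c(2) SUP_upper[OF that] order_le_less_trans by blast
    then show ?thesis by (auto simp: gdist_def INF_less_iff less_Suc_eq_le)
  qed
  then show ?thesis using c(1) unfolding within_radius_def by blast
qed

lemma adj_mono: "edges b \<subseteq> edges G \<Longrightarrow> adj b \<subseteq> adj G"
  by (auto simp: adj_def)

lemma within_radius_cut_connected:
  assumes "within_radius r b (verts b)" "subgraph b G"
  shows "cut_connected G (verts b)"
proof -
  obtain c where c: "c \<in> verts b" "\<And>v. v \<in> verts b \<Longrightarrow> \<exists>k. (c, v) \<in> adj b ^^ k"
    using assms(1) unfolding within_radius_def by meson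
  then have reach: "(c, v) \<in> (adj b)\<^sup>*" if "v \<in> verts b" for v
    using that by (meson relpow_imp_rtrancl)
  have edge: "x \<in> verts b \<and> y \<in> verts b \<and> {x, y} \<in> edges G" if "(x, y) \<in> adj b" for x y
    using assms(2) that by (auto simp: subgraph_def simple_graph_def adj_def)
  have "verts b \<subseteq> Z"
    if "Z \<inter> verts b \<noteq> {}" and Z: "\<forall>x\<in>verts b \<inter> Z. \<forall>y\<in>verts b. {x, y} \<in> edges G \<longrightarrow> y \<in> Z" for Z
  proof
    from that obtain z where z: "z \<in> verts b" "z \<in> Z" by blast
    fix v assume v: "v \<in> verts b"
    have "(z, c) \<in> (adj b)\<^sup>*" using reach[OF z(1)] sym_rtrancl[OF sym_adj] by (metis symD)
    then have "(z, v) \<in> (adj b)\<^sup>*" using reach[OF v] by (rule rtrancl_trans)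
    then show "v \<in> Z"
    proof (induction rule: rtrancl_induct)
      case base
      then show ?case using z by simp
    next
      case (step x y)
      then show ?case using Z edge[OF step(2)] by blast
    qed
  qed
  then show ?thesis using c(1) unfolding cut_connected_def by blast
qed

lemma relpow_adj_mono:
  assumes "edges b \<subseteq> edges G" "(u, v) \<in> adj b ^^ k"
  shows "(u, v) \<in> adj G ^^ k"
  using assms(2) adj_mono[OF assms(1)] by (induction k arbitrary: v) (auto intro: relcompI)

lemma relpow_adj_sym: "(u, v) \<in> adj G ^^ k \<Longrightarrow> (v, u) \<in> adj G ^^ k"
proof (induction k arbitrary: v)
  case (Suc k)
  then obtain w where "(u, w) \<in> adj G ^^ k" "(w, v) \<in> adj G" by auto
  then show ?case using Suc.IH sym_adj by (metis relpow_Suc_I2 symD)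
qed simp

lemma within_radius_mono:
  assumes "within_radius r b X" "edges b \<subseteq> edges G"
  shows "within_radius r G X"
  using assms(1) relpow_adj_mono[OF assms(2)] unfolding within_radius_def by meson

text \<open>Reduces a minor to its branch sets in \<open>G\<close>. Uncontracted vertices become
  branch sets of radius 0.\<close>

lemma shallow_minorE:
  assumes "simple_graph G" "shallow_minor r G H"
  shows "\<And>X. X \<in> verts H \<Longrightarrow> X \<subseteq> verts G \<and> cut_connected G X \<and> within_radius r G X"
    and "\<And>X Y. X \<in> verts H \<Longrightarrow> Y \<in> verts H \<Longrightarrow> X \<noteq> Y \<Longrightarrow> X \<inter> Y = {}"
    and "\<And>e. e \<in> edges H \<Longrightarrow> \<exists>X\<in>verts H. \<exists>Y\<in>verts H. X \<noteq> Y \<and> e = {X, Y} \<and>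
      (\<exists>x\<in>X. \<exists>y\<in>Y. {x, y} \<in> edges G)"
proof -
  obtain S B where S: "subgraph S G" and B: "\<And>b. b \<in> B \<Longrightarrow> subgraph b S \<and> radius b \<le> enat r"
    and disj: "pairwise (\<lambda>b b'. verts b \<inter> verts b' = {}) B" and H: "H = contract S B"
    using assms(2) by (auto simp: shallow_minor_def)
  have W: "verts H = verts ` B \<union> {{v} |v. v \<in> verts S - \<Union> (verts ` B)}"
    by (simp add: H contract_def Let_def)
  show "X \<subseteq> verts G \<and> cut_connected G X \<and> within_radius r G X" if "X \<in> verts H" for X
  proof -
    from that consider b where "b \<in> B" "X = verts b" | v where "v \<in> verts S" "X = {v}"
      unfolding W by blast
    then show ?thesis
    proof cases
      case 1
      have b: "subgraph b G" using B[OF 1(1)] S by (auto simp: subgraph_def)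
      have "within_radius r b (verts b)" using B[OF 1(1)] by (simp add: radius_le_enat)
      then show ?thesis
        using b 1 within_radius_cut_connected within_radius_mono by (auto simp: subgraph_def)
    next
      case 2
      have "(v, v) \<in> adj G ^^ 0" by simp
      then show ?thesis
        using 2 S by (auto simp: subgraph_def cut_connected_def within_radius_def)
    qed
  qed
  show "X \<inter> Y = {}" if "X \<in> verts H" "Y \<in> verts H" "X \<noteq> Y" for X Y
  proof (rule ccontr)
    assume "X \<inter> Y \<noteq> {}"
    then obtain v where v: "v \<in> X" "v \<in> Y" by blast
    show False
    proof (cases "v \<in> \<Union> (verts ` B)")
      case True
      with that(1,2) v obtain b b' where b: "b \<in> B" "b' \<in> B" "X = verts b" "Y = verts b'" unfolding W by blast
      then have "b \<noteq> b'" using that(3) by blast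
      then show False using pairwiseD[OF disj b(1,2)] b v by blast
    next
      case False
      then have "X = {v}" "Y = {v}" using that(1,2) v unfolding W by blast+
      then show False using that(3) by simp
    qed
  qed
  show "\<exists>X\<in>verts H. \<exists>Y\<in>verts H. X \<noteq> Y \<and> e = {X, Y} \<and> (\<exists>x\<in>X. \<exists>y\<in>Y. {x, y} \<in> edges G)"
    if "e \<in> edges H" for e
  proof -
    have "\<exists>X Y. e = {X, Y} \<and> X \<in> verts H \<and> Y \<in> verts H \<and> X \<noteq> Y \<and>
        (\<exists>x\<in>X. \<exists>y\<in>Y. {x, y} \<in> edges S)"
      using that by (simp add: H contract_def Let_def)
    then obtain X Y x y where XY: "e = {X, Y}" "X \<in> verts H" "Y \<in> verts H" "X \<noteq> Y"
      and xy: "x \<in> X" "y \<in> Y" "{x, y} \<in> edges S" by (elim exE bexE conjE) (rule that)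
    have "{x, y} \<in> edges G" using xy(3) S by (auto simp: subgraph_def)
    then have "\<exists>x\<in>X. \<exists>y\<in>Y. {x, y} \<in> edges G" using xy(1,2) by blast
    with XY show ?thesis by (intro bexI[of _ X] bexI[of _ Y] conjI)
  qed
qed

text \<open>\<open>nabla\<close> is a \<open>Max\<close>, so the minors must be finite in number and
  at least one: all of them live on subsets of \<open>verts G\<close>, and contracting nothing gives
  one.\<close>

lemma nabla_le:
  assumes "simple_graph G" "\<And>H. shallow_minor r G H \<Longrightarrow> density H \<le> D"
  shows "nabla r G \<le> D"
proof -
  let ?V = "verts G"
  have fin: "finite ?V" using assms(1) by (simp add: simple_graph_def)
  have "H \<in> (\<lambda>(W, E). \<lparr>verts = W, edges = E\<rparr>) ` (Pow (Pow ?V) \<times> Pow (Pow (Pow ?V)))"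
    if "shallow_minor r G H" for H
  proof -
    have "verts H \<subseteq> Pow ?V" using shallow_minorE(1)[OF assms(1) that] by blast
    moreover have "edges H \<subseteq> Pow (Pow ?V)"
      using shallow_minorE(1,3)[OF assms(1) that] by fastforce
    ultimately show ?thesis by (intro image_eqI[of _ _ "(verts H, edges H)"]) auto
  qed
  then have "{H. shallow_minor r G H} \<subseteq>
      (\<lambda>(W, E). \<lparr>verts = W, edges = E\<rparr>) ` (Pow (Pow ?V) \<times> Pow (Pow (Pow ?V)))" by blast
  then have "finite {H. shallow_minor r G H}" using fin by (auto intro: finite_subset)
  moreover have "shallow_minor r G (contract G {})"
    using assms(1) unfolding shallow_minor_def by (intro exI[of _ G] exI[of _ "{}"]) (auto simp: subgraph_def)
  ultimately show ?thesis using assms(2) unfolding nabla_def by (subst Max_le_iff) auto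
qed

lemma card_le_one:
  assumes "\<And>a b. a \<in> S \<Longrightarrow> b \<in> S \<Longrightarrow> a = b"
  shows "finite S" "card S \<le> 1"
proof -
  have S: "S = {} \<or> (\<exists>a. S = {a})" using assms by blast
  then show "finite S" "card S \<le> 1" by auto
qed

lemma card_UN_le_card:
  assumes "finite I" "\<And>i a b. i \<in> I \<Longrightarrow> a \<in> S i \<Longrightarrow> b \<in> S i \<Longrightarrow> a = b"
  shows "finite (\<Union>i\<in>I. S i)" "card (\<Union>i\<in>I. S i) \<le> card I"
proof -
  have S: "finite (S i) \<and> card (S i) \<le> 1" if "i \<in> I" for i
    using card_le_one[of "S i"] assms(2)[OF that] by blast
  then show "finite (\<Union>i\<in>I. S i)" using assms(1) by auto
  have "card (\<Union>i\<in>I. S i) \<le> (\<Sum>i\<in>I. card (S i))" using assms(1) by (rule card_UN_le)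
  also have "\<dots> \<le> (\<Sum>i\<in>I. 1)" using S by (intro sum_mono) auto
  finally show "card (\<Union>i\<in>I. S i) \<le> card I" by simp
qed

lemma route_eq_Hub:
  "route L f p t = Hub i \<longleftrightarrow> t = 0 \<and> fst p = i \<or> 0 < t \<and> L < t \<and> f p = i"
  by (auto simp: route_def)

context labelled begin

section \<open>Branch sets along routes and around hubs\<close>

lemma inj_labelD: "x \<in> verts G \<Longrightarrow> y \<in> verts G \<Longrightarrow> g x = g y \<Longrightarrow> x = y"
  using inj_label by (rule inj_onD)

text \<open>The vertex at position \<open>t + 1\<close> is outside \<open>X\<close>, so the
  connected set \<open>X\<close> can leave the positions up to \<open>t\<close> only through the hub
  where the route starts.\<close>

lemma route_prefix:
  assumes "X \<subseteq> verts G" "cut_connected G X" "x \<in> X" "g x = Mid p t"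
    and "y \<in> verts G - X" "g y = route L f p (Suc t)"
  shows "(\<forall>z\<in>X. \<exists>s\<le>t. g z = Mid p s) \<or> (\<exists>z\<in>X. g z = Hub (fst p))"
proof (rule disjCI)
  assume no_hub: "\<not> (\<exists>z\<in>X. g z = Hub (fst p))"
  let ?Z = "{z. \<exists>s\<le>t. g z = Mid p s}"
  have "b \<in> ?Z" if "a \<in> X" "a \<in> ?Z" "b \<in> X" "{a, b} \<in> edges G" for a b
  proof -
    from that(2) obtain s where s: "s \<le> t" "g a = Mid p s" by blast
    have "1 \<le> s" "t \<le> L" using Mid_range s assms that by blast+
    from Mid_neighbour[OF that(4) s(2)] show ?thesis
    proof
      assume "g b = route L f p (s - 1)"
      moreover have "g b \<noteq> Hub (fst p)" using no_hub that(3) by blast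
      ultimately show ?thesis using s \<open>t \<le> L\<close> by (auto simp: route_def split: if_splits)
    next
      assume b: "g b = route L f p (Suc s)"
      have "b \<noteq> y" using that(3) assms(5) by blast
      then have "g b \<noteq> g y" using inj_labelD that(3) assms(1,5) by blast
      then have "s < t" using b assms(6) s(1) by (cases "s = t") auto
      then show ?thesis using b \<open>t \<le> L\<close> by auto
    qed
  qed
  note step = this
  have "x \<in> ?Z" using assms(4) by blast
  from cut_connectedD[OF assms(2,3) this step] have "X \<subseteq> ?Z" .
  then show "\<forall>z\<in>X. \<exists>s\<le>t. g z = Mid p s" by blast
qed

text \<open>Mirror image of \<open>route_prefix\<close>, with the hub where the route ends.\<close>

lemma route_suffix:
  assumes "X \<subseteq> verts G" "cut_connected G X" "x \<in> X" "g x = Mid p (Suc t)"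
    and "y \<in> verts G - X" "g y = route L f p t"
  shows "(\<forall>z\<in>X. \<exists>s>t. g z = Mid p s) \<or> (\<exists>z\<in>X. g z = Hub (f p))"
proof (rule disjCI)
  assume no_hub: "\<not> (\<exists>z\<in>X. g z = Hub (f p))"
  let ?Z = "{z. \<exists>s>t. g z = Mid p s}"
  have "b \<in> ?Z" if "a \<in> X" "a \<in> ?Z" "b \<in> X" "{a, b} \<in> edges G" for a b
  proof -
    from that(2) obtain s where s: "t < s" "g a = Mid p s" by blast
    have "1 \<le> s" "s \<le> L" using Mid_range s assms that by blast+
    from Mid_neighbour[OF that(4) s(2)] show ?thesis
    proof
      assume "g b = route L f p (Suc s)"
      moreover have "g b \<noteq> Hub (f p)" using no_hub that(3) by blast
      ultimately show ?thesis using s by (auto simp: route_def split: if_splits)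
    next
      assume b: "g b = route L f p (s - 1)"
      have "b \<noteq> y" using that(3) assms(5) by blast
      then have "g b \<noteq> g y" using inj_labelD that(3) assms(1,5) by blast
      then have "t < s - 1" using b assms(6) s(1) by (cases "t = s - 1") auto
      then show ?thesis using b \<open>s \<le> L\<close> by auto
    qed
  qed
  note step = this
  have "x \<in> ?Z" using assms(4) by blast
  from cut_connectedD[OF assms(2,3) this step] have "X \<subseteq> ?Z" .
  then show "\<forall>z\<in>X. \<exists>s>t. g z = Mid p s" by blast
qed

text \<open>Induction on the length of the walk: each step moves one position along a route at hub
  \<open>i\<close>, and a different hub is \<open>L + 1\<close> steps away.\<close>

lemma hub_ball:
  assumes "(u, v) \<in> adj G ^^ k" "g u = Hub i" "k \<le> L"
  shows "g v = Hub i \<or> (\<exists>p t. g v = Mid p t \<and> (fst p = i \<and> t \<le> k \<or> f p = i \<and> L < t + k))"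
  using assms(1,3)
proof (induction k arbitrary: v)
  case 0
  then show ?case using assms(2) by simp
next
  case (Suc k)
  then obtain w where w: "(u, w) \<in> adj G ^^ k" "{w, v} \<in> edges G" by (auto simp: adj_def)
  let ?near = "\<lambda>q s. fst q = i \<and> s \<le> Suc k \<or> f q = i \<and> L < s + Suc k"
  have near: ?case if "g v = route L f q s" "?near q s" "s \<le> Suc L" for q s
    using that L_pos Suc.prems(2) by (auto simp: route_def simp del: split_paired_Ex)
  from Suc.IH[OF w(1)] Suc.prems(2) consider "g w = Hub i"
    | q s where "g w = Mid q s" "fst q = i" "s \<le> k"
    | q s where "g w = Mid q s" "f q = i" "L < s + k" by auto
  then show ?case
  proof cases
    case 1
    from w(2) obtain q s where q: "s \<le> L"
      "g w = route L f q s \<and> g v = route L f q (Suc s) \<or> g v = route L f q s \<and> g w = route L f q (Suc s)"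
      by (rule edgeE)
    from q(2) show ?thesis
    proof
      assume a: "g w = route L f q s \<and> g v = route L f q (Suc s)"
      then have "route L f q s = Hub i" using 1 by simp
      then have "s = 0" "fst q = i" using q(1) by (auto simp: route_eq_Hub)
      then show ?thesis using near[of q "Suc s"] a by simp
    next
      assume a: "g v = route L f q s \<and> g w = route L f q (Suc s)"
      then have "route L f q (Suc s) = Hub i" using 1 by simp
      then have "s = L" "f q = i" using q(1) by (auto simp: route_eq_Hub)
      then show ?thesis using near[of q s] a by simp
    qed
  next
    case (2 q s)
    then have "s \<le> L" using Suc.prems(2) by simp
    from Mid_neighbour[OF w(2) 2(1)] show ?thesis
      by (elim disjE; intro near) (use 2 \<open>s \<le> L\<close> in auto)
  next
    case (3 q s)
    then have "w \<in> verts G" using edge_verts[OF w(2)] by simp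
    then have "1 \<le> s" "s \<le> L" using Mid_range 3 by blast+
    from Mid_neighbour[OF w(2) 3(1)] show ?thesis
      by (elim disjE; intro near) (use 3 \<open>s \<le> L\<close> \<open>1 \<le> s\<close> in auto)
  qed
qed

text \<open>The centre is within \<open>r\<close> steps of both hubs. If they differed, it would be
  at a position at most \<open>r\<close> and beyond \<open>L - r\<close> on one route, or the
  reverse, against \<open>2 * r \<le> L\<close>.\<close>

lemma hub_unique:
  assumes "within_radius r G X" "2 * r \<le> L" "x \<in> X" "y \<in> X" "g x = Hub i" "g y = Hub j"
  shows "i = j"
proof -
  obtain c where c: "\<And>v. v \<in> X \<Longrightarrow> \<exists>k\<le>r. (c, v) \<in> adj G ^^ k"
    using assms(1) by (auto simp: within_radius_def)
  then have "\<exists>k\<le>r. (v, c) \<in> adj G ^^ k" if "v \<in> X" for v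
    using that relpow_adj_sym by meson
  then obtain k l where kl: "k \<le> r" "(x, c) \<in> adj G ^^ k" "l \<le> r" "(y, c) \<in> adj G ^^ l"
    using assms(3,4) by meson
  show ?thesis
    using hub_ball[OF kl(2) assms(5)] hub_ball[OF kl(4) assms(6)] kl(1,3) assms(2) by auto
qed

text \<open>An edge of the minor between two branch sets is the route step from position \<open>t\<close> to
  \<open>t + 1\<close>. If the first set has no hub, the edge leaves its last position; if the second has none,
  the edge leaves its first position; otherwise the sets contain the two ends of the route.\<close>

lemma card_minor_edges:
  assumes W: "finite W"
    and conn: "\<And>X. X \<in> W \<Longrightarrow> X \<subseteq> verts G \<and> cut_connected G X"
    and disj: "\<And>X Y. X \<in> W \<Longrightarrow> Y \<in> W \<Longrightarrow> X \<noteq> Y \<Longrightarrow> X \<inter> Y = {}"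
    and E: "\<And>e. e \<in> E \<Longrightarrow> \<exists>X\<in>W. \<exists>Y\<in>W. X \<noteq> Y \<and> e = {X, Y} \<and> (\<exists>x\<in>X. \<exists>y\<in>Y. {x, y} \<in> edges G)"
  shows "card E \<le> 2 * card W + d * m" "card E \<le> 2 * card W + card W * card W"
    and "(\<And>X x y i j. X \<in> W \<Longrightarrow> x \<in> X \<Longrightarrow> y \<in> X \<Longrightarrow> g x = Hub i \<Longrightarrow> g y = Hub j \<Longrightarrow> i = j)
      \<Longrightarrow> card E \<le> 2 * card W + d * card W"
proof -
  \<comment> \<open>Each of the three families has at most one edge per index: the last or first
    position of a hub-free set determines the position next to it, and a route determines its two
    end hubs.\<close>
  define last_edge where "last_edge = (\<lambda>X. {e. \<exists>Y\<in>W. \<exists>x\<in>X. \<exists>y\<in>Y. \<exists>p t. g x = Mid p t \<and>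
    g y = route L f p (Suc t) \<and> (\<forall>z\<in>X. \<exists>s\<le>t. g z = Mid p s) \<and> e = {X, Y}})"
  define first_edge where "first_edge = (\<lambda>X. {e. \<exists>Y\<in>W. \<exists>x\<in>X. \<exists>y\<in>Y. \<exists>p t. g x = Mid p (Suc t) \<and>
    g y = route L f p t \<and> (\<forall>z\<in>X. \<exists>s>t. g z = Mid p s) \<and> e = {X, Y}})"
  define end_edge where "end_edge = (\<lambda>p. {e. \<exists>X\<in>W. \<exists>Y\<in>W. \<exists>x\<in>X. \<exists>y\<in>Y.
    g x = Hub (fst p) \<and> g y = Hub (f p) \<and> e = {X, Y}})"
  define P where "P = {..<m} \<times> {..<d}"
  define main where "main = (\<Union>p\<in>P. end_edge p)"
  have same: "X = Y" if "X \<in> W" "Y \<in> W" "x \<in> X" "y \<in> Y" "g x = g y" for X Y x y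
  proof -
    have "x = y" using that conn inj_labelD by blast
    then show ?thesis using that disj by blast
  qed
  have "e \<in> (\<Union>X\<in>W. last_edge X) \<union> (\<Union>X\<in>W. first_edge X) \<union> main" if "e \<in> E" for e
  proof -
    obtain X Y x y where XY: "X \<in> W" "Y \<in> W" "X \<noteq> Y" "e = {X, Y}" "x \<in> X" "y \<in> Y" "{x, y} \<in> edges G"
      using E[OF \<open>e \<in> E\<close>] by (elim bexE conjE) (rule that)
    have *: ?thesis
      if XY: "X \<in> W" "Y \<in> W" "X \<noteq> Y" "e = {X, Y}" "x \<in> X" "y \<in> Y"
        and p: "p \<in> P" "t \<le> L" "g x = route L f p t" "g y = route L f p (Suc t)" for X Y x y p t
    proof -
      have nin: "x \<in> verts G - Y" "y \<in> verts G - X" using XY disj conn by blast+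
      have X: "X \<subseteq> verts G" "cut_connected G X" and Y: "Y \<subseteq> verts G" "cut_connected G Y"
        using conn XY by auto
      have 1: "e \<in> last_edge X \<or> (\<exists>z\<in>X. g z = Hub (fst p))"
      proof (cases "t = 0")
        case True
        then show ?thesis using p XY by auto
      next
        case False
        then have "g x = Mid p t" using p by simp
        from route_prefix[OF X XY(5) this nin(2) p(4)] show ?thesis
          using XY p(4) \<open>g x = Mid p t\<close> unfolding last_edge_def by blast
      qed
      have 2: "e \<in> first_edge Y \<or> (\<exists>z\<in>Y. g z = Hub (f p))"
      proof (cases "t = L")
        case True
        then show ?thesis using p XY by auto
      next
        case False
        then have *: "g y = Mid p (Suc t)" using p by simp
        have "e = {Y, X}" using XY(4) by (simp add: insert_commute)
        with route_suffix[OF Y XY(6) * nin(1) p(3)] show ?thesis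
          using XY p(3) * unfolding first_edge_def by blast
      qed
      have 3: "e \<in> end_edge p" if "\<exists>z\<in>X. g z = Hub (fst p)" "\<exists>z\<in>Y. g z = Hub (f p)"
      proof -
        from that obtain a b where "a \<in> X" "g a = Hub (fst p)" "b \<in> Y" "g b = Hub (f p)" by blast
        with XY(1,2,4) show ?thesis unfolding end_edge_def mem_Collect_eq
          by (intro bexI[of _ X] bexI[of _ Y] bexI[of _ a] bexI[of _ b] conjI)
      qed
      from 1 2 show ?thesis
      proof (elim disjE)
        assume "\<exists>z\<in>X. g z = Hub (fst p)" "\<exists>z\<in>Y. g z = Hub (f p)"
        then have "e \<in> main" using 3 p(1) unfolding main_def by blast
        then show ?thesis by simp
      qed (use XY(1,2) in auto)
    qed
    show ?thesis using XY(7)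
    proof (cases rule: edgeE)
      case (1 p t)
      have "e = {Y, X}" using XY(4) by (simp add: insert_commute)
      then show ?thesis using * XY 1 unfolding P_def by metis
    qed
  qed
  then have E_sub: "E \<subseteq> (\<Union>X\<in>W. last_edge X) \<union> (\<Union>X\<in>W. first_edge X) \<union> main" by blast
  have last: "a = b" if "X \<in> W" "a \<in> last_edge X" "b \<in> last_edge X" for X a b
  proof -
    from that obtain Y x y p t where a: "Y \<in> W" "x \<in> X" "y \<in> Y" "g x = Mid p t" "g y = route L f p (Suc t)"
      "\<forall>z\<in>X. \<exists>s\<le>t. g z = Mid p s" "a = {X, Y}" by (auto simp: last_edge_def)
    from that obtain Y' x' y' p' t' where b: "Y' \<in> W" "x' \<in> X" "y' \<in> Y'" "g x' = Mid p' t'"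
      "g y' = route L f p' (Suc t')" "\<forall>z\<in>X. \<exists>s\<le>t'. g z = Mid p' s" "b = {X, Y'}" by (auto simp: last_edge_def)
    have "p = p' \<and> t \<le> t'" using a(2,4) b(6) by fastforce
    moreover have "t' \<le> t" using b(2,4) a(6) by fastforce
    ultimately show ?thesis using same[of Y Y' y y'] a b by simp
  qed
  have first: "a = b" if "X \<in> W" "a \<in> first_edge X" "b \<in> first_edge X" for X a b
  proof -
    from that obtain Y x y p t where a: "Y \<in> W" "x \<in> X" "y \<in> Y" "g x = Mid p (Suc t)" "g y = route L f p t"
      "\<forall>z\<in>X. \<exists>s>t. g z = Mid p s" "a = {X, Y}" by (auto simp: first_edge_def)
    from that obtain Y' x' y' p' t' where b: "Y' \<in> W" "x' \<in> X" "y' \<in> Y'" "g x' = Mid p' (Suc t')"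
      "g y' = route L f p' t'" "\<forall>z\<in>X. \<exists>s>t'. g z = Mid p' s" "b = {X, Y'}" by (auto simp: first_edge_def)
    have "p = p' \<and> t' \<le> t" using a(2,4) b(6) by fastforce
    moreover have "t \<le> t'" using b(2,4) a(6) by fastforce
    ultimately show ?thesis using same[of Y Y' y y'] a b by simp
  qed
  have main_eq: "a = b" if "a \<in> end_edge p" "b \<in> end_edge p" for a b p
  proof -
    from that obtain X Y x y where a: "X \<in> W" "Y \<in> W" "x \<in> X" "y \<in> Y" "g x = Hub (fst p)" "g y = Hub (f p)"
      "a = {X, Y}" by (auto simp: end_edge_def)
    from that obtain X' Y' x' y' where b: "X' \<in> W" "Y' \<in> W" "x' \<in> X'" "y' \<in> Y'" "g x' = Hub (fst p)"
      "g y' = Hub (f p)" "b = {X', Y'}" by (auto simp: end_edge_def)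
    show ?thesis using same[of X X' x x'] same[of Y Y' y y'] a b by simp
  qed
  have finP: "finite P" by (simp add: P_def)
  have L: "finite (\<Union>X\<in>W. last_edge X)" "card (\<Union>X\<in>W. last_edge X) \<le> card W"
    by (rule card_UN_le_card[OF W], erule (2) last)+
  have F: "finite (\<Union>X\<in>W. first_edge X)" "card (\<Union>X\<in>W. first_edge X) \<le> card W"
    by (rule card_UN_le_card[OF W], erule (2) first)+
  have M: "finite main" "card main \<le> card P"
    unfolding main_def by (rule card_UN_le_card[OF finP], erule (1) main_eq)+
  have "card E \<le> card ((\<Union>X\<in>W. last_edge X) \<union> (\<Union>X\<in>W. first_edge X) \<union> main)"
    using L(1) F(1) M(1) by (intro card_mono E_sub) auto
  also have "\<dots> \<le> card (\<Union>X\<in>W. last_edge X) + card (\<Union>X\<in>W. first_edge X) + card main"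
    by (meson add_mono_thms_linordered_semiring(3) card_Un_le le_trans)
  also have "\<dots> \<le> 2 * card W + card main" using L(2) F(2) by simp
  finally have le: "card E \<le> 2 * card W + card main" .
  have "card P = d * m" by (simp add: P_def card_cartesian_product)
  then show "card E \<le> 2 * card W + d * m" using le M(2) by simp
  \<comment> \<open>Second bound for \<open>main\<close>: its edges are pairs of branch
    sets.\<close>
  have "main \<subseteq> (\<lambda>(X, Y). {X, Y}) ` (W \<times> W)" by (auto simp: main_def end_edge_def)
  then have "card main \<le> card (W \<times> W)"
    using W by (meson card_image_le card_mono finite_SigmaI finite_imageI le_trans)
  then show "card E \<le> 2 * card W + card W * card W" using le by (simp add: card_cartesian_product)
  assume one: "\<And>X x y i j. X \<in> W \<Longrightarrow> x \<in> X \<Longrightarrow> y \<in> X \<Longrightarrow> g x = Hub i \<Longrightarrow> g y = Hub j \<Longrightarrow> i = j"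
  \<comment> \<open>Third bound for \<open>main\<close>: if \<open>X\<close> has a single hub, then
    \<open>X\<close> and the index \<open>j\<close> of a route out of that hub determine the
    edge.\<close>
  define S where "S = (\<lambda>(X, j). {e. \<exists>Y\<in>W. \<exists>x\<in>X. \<exists>y\<in>Y. \<exists>i.
    g x = Hub i \<and> g y = Hub (f (i, j)) \<and> e = {X, Y}})"
  have "a = b" if "q \<in> W \<times> {..<d}" "a \<in> S q" "b \<in> S q" for q a b
  proof -
    from that obtain X j where q: "q = (X, j)" "X \<in> W" by auto
    from that q obtain Y x y i where a: "Y \<in> W" "x \<in> X" "y \<in> Y" "g x = Hub i" "g y = Hub (f (i, j))" "a = {X, Y}" by (auto simp: S_def)
    from that q obtain Y' x' y' i' where b: "Y' \<in> W" "x' \<in> X" "y' \<in> Y'" "g x' = Hub i'" "g y' = Hub (f (i', j))"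
      "b = {X, Y'}" by (auto simp: S_def)
    have "i = i'" using one q a b by blast
    then show ?thesis using same[of Y Y' y y'] a b by simp
  qed
  note S = card_UN_le_card[of "W \<times> {..<d}" S, OF _ this]
  have "main \<subseteq> (\<Union>q\<in>W \<times> {..<d}. S q)"
  proof
    fix e assume "e \<in> main"
    then obtain i j X Y x y where "j < d" "X \<in> W" "Y \<in> W" "x \<in> X" "y \<in> Y" "g x = Hub i"
      "g y = Hub (f (i, j))" "e = {X, Y}" by (auto simp: main_def end_edge_def P_def)
    then have "(X, j) \<in> W \<times> {..<d}" "e \<in> S (X, j)" by (auto simp: S_def)
    then show "e \<in> (\<Union>q\<in>W \<times> {..<d}. S q)" by blast
  qed
  then have "card main \<le> card (\<Union>q\<in>W \<times> {..<d}. S q)" using S(1) W by (intro card_mono) auto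
  also have "\<dots> \<le> d * card W" using S(2) W by (simp add: card_cartesian_product mult.commute)
  finally show "card E \<le> 2 * card W + d * card W" using le by simp
qed

lemma shallow_minor_finite_verts:
  assumes "shallow_minor r G H"
  shows "finite (verts H)"
proof (rule finite_subset)
  show "verts H \<subseteq> Pow (verts G)" using shallow_minorE(1)[OF simple assms] by blast
qed (simp add: finite_verts)

text \<open>With \<open>w\<close> branch sets, the edges beyond \<open>2 w\<close> number at most
  the minimum of \<open>d m\<close> and w^2, which is at most the geometric mean
  \<open>w * sqrt (d m)\<close>.\<close>

lemma nabla_le_hubs: "nabla r G \<le> 2 + sqrt (real (d * m))"
proof (rule nabla_le[OF simple])
  fix H assume H: "shallow_minor r G H"
  let ?w = "real (card (verts H))" and ?e = "real (card (edges H))"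
  have *: "card (edges H) \<le> 2 * card (verts H) + d * m"
    "card (edges H) \<le> 2 * card (verts H) + card (verts H) * card (verts H)"
    using card_minor_edges(1,2)[OF shallow_minor_finite_verts[OF H], of "edges H"]
      shallow_minorE[OF simple H] by auto
  have "?e \<le> 2 * ?w + sqrt (real (d * m)) * ?w"
  proof (cases "?w \<le> sqrt (real (d * m))")
    case True
    then have "?w * ?w \<le> sqrt (real (d * m)) * ?w" by (intro mult_right_mono) auto
    moreover have "?e \<le> 2 * ?w + ?w * ?w" using *(2) by (simp flip: of_nat_mult of_nat_add)
    ultimately show ?thesis by linarith
  next
    case False
    then have "sqrt (real (d * m)) * sqrt (real (d * m)) \<le> sqrt (real (d * m)) * ?w"
      by (intro mult_left_mono) auto
    moreover have "sqrt (real (d * m)) * sqrt (real (d * m)) = real (d * m)" by simp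
    moreover have "?e \<le> 2 * ?w + real (d * m)" using *(1) by linarith
    ultimately show ?thesis by linarith
  qed
  then show "density H \<le> 2 + sqrt (real (d * m))"
    by (cases "?w = 0") (auto simp: density_def divide_simps algebra_simps)
qed

text \<open>Branch sets of this radius hold at most one hub each, so each accounts for at most
  \<open>d\<close> edges besides the \<open>2 w\<close> ones.\<close>

lemma nabla_le_degree:
  assumes "2 * r \<le> L"
  shows "nabla r G \<le> 2 + real d"
proof (rule nabla_le[OF simple])
  fix H assume H: "shallow_minor r G H"
  have "card (edges H) \<le> 2 * card (verts H) + d * card (verts H)"
  proof (rule card_minor_edges(3))
    fix X x y i j
    assume "X \<in> verts H" "x \<in> X" "y \<in> X" "g x = Hub i" "g y = Hub j"
    then show "i = j" using hub_unique[OF _ assms] shallow_minorE(1)[OF simple H] by blast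
  qed (use shallow_minor_finite_verts[OF H] shallow_minorE[OF simple H] in auto)
  then have "real (card (edges H)) \<le> real ((2 + d) * card (verts H))"
    by (simp only: of_nat_le_iff) (simp add: algebra_simps)
  then show "density H \<le> 2 + real d"
    by (cases "card (verts H) = 0") (auto simp: density_def divide_simps algebra_simps)
qed

end

section \<open>The hereditary class\<close>

lemma labelled_iff:
  "labelled G g d m L f \<longleftrightarrow> simple_graph G \<and> L \<ge> 1 \<and> inj_on g (verts G) \<and>
     g ` verts G \<subseteq> verts (subdivision d m L f) \<and>
     (\<forall>e\<in>edges G. g ` e \<in> edges (subdivision d m L f))"
proof -
  have "(\<forall>u v. {u, v} \<in> edges G \<longrightarrow> {g u, g v} \<in> edges (subdivision d m L f)) \<longleftrightarrow>
      (\<forall>e\<in>edges G. g ` e \<in> edges (subdivision d m L f))" if "simple_graph G"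
  proof (intro iffI ballI allI impI)
    fix e assume *: "\<forall>u v. {u, v} \<in> edges G \<longrightarrow> {g u, g v} \<in> edges (subdivision d m L f)"
      and e: "e \<in> edges G"
    obtain u v where "e = {u, v}" using e \<open>simple_graph G\<close> by (metis card_2_iff simple_graph_def)
    then show "g ` e \<in> edges (subdivision d m L f)" using * e by simp
  next
    fix u v assume "\<forall>e\<in>edges G. g ` e \<in> edges (subdivision d m L f)" "{u, v} \<in> edges G"
    then have "g ` {u, v} \<in> edges (subdivision d m L f)" by blast
    then show "{g u, g v} \<in> edges (subdivision d m L f)" by simp
  qed
  then show ?thesis unfolding labelled_def by auto
qed

definition subdivided_class :: "real \<Rightarrow> nat ugraph set" where
  "subdivided_class \<epsilon> = {G. \<exists>g m L f. 1 \<le> m \<and> real m powr \<epsilon> \<le> real L powr (1 - \<epsilon>) \<and>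
     labelled G g 48 m L f}"

lemma subdivided_classI:
  "1 \<le> m \<Longrightarrow> real m powr \<epsilon> \<le> real L powr (1 - \<epsilon>) \<Longrightarrow> labelled G g 48 m L f
    \<Longrightarrow> G \<in> subdivided_class \<epsilon>"
  by (auto simp: subdivided_class_def)

lemma subdivided_classE:
  assumes "G \<in> subdivided_class \<epsilon>"
  obtains g m L f where "1 \<le> m" "real m powr \<epsilon> \<le> real L powr (1 - \<epsilon>)" "labelled G g 48 m L f"
  using assms by (auto simp: subdivided_class_def)

section \<open>Closure under isomorphism and induced subgraphs\<close>

lemma labelled_iso:
  assumes "labelled G g d m L f" "simple_graph H" "graph_iso G H"
  shows "\<exists>g'. labelled H g' d m L f"
proof -
  obtain h where h: "bij_betw h (verts G) (verts H)" "edges H = (`) h ` edges G"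
    using assms(3) unfolding graph_iso_def by auto
  let ?k = "inv_into (verts G) h"
  have k: "bij_betw ?k (verts H) (verts G)" using h(1) by (rule bij_betw_inv_into)
  have "(g \<circ> ?k) ` e \<in> edges (subdivision d m L f)" if "e \<in> edges H" for e
  proof -
    obtain e' where e': "e' \<in> edges G" "e = h ` e'" using \<open>e \<in> edges H\<close> h(2) by auto
    then have "e' \<subseteq> verts G" using assms(1) by (simp add: labelled_iff simple_graph_def)
    then have "?k ` h ` e' = e'" using h(1) by (metis bij_betw_def inv_into_image_cancel)
    then have "(g \<circ> ?k) ` e = g ` e'" using e'(2) by (metis image_comp)
    then show ?thesis using e'(1) assms(1) by (simp add: labelled_iff)
  qed
  moreover have "inj_on (g \<circ> ?k) (verts H)"
    using k assms(1) by (auto simp: labelled_iff bij_betw_def intro!: comp_inj_on)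
  moreover have "(g \<circ> ?k) ` verts H = g ` verts G"
    using k by (metis bij_betw_def image_comp)
  ultimately have "labelled H (g \<circ> ?k) d m L f" using assms(1,2) by (simp add: labelled_iff)
  then show ?thesis by blast
qed

lemma labelled_induced:
  assumes "labelled G g d m L f"
  shows "labelled (induced G X) g d m L f"
proof -
  have "simple_graph (induced G X)"
    using assms by (auto simp: labelled_iff induced_def simple_graph_def)
  moreover have "verts (induced G X) \<subseteq> verts G" "edges (induced G X) \<subseteq> edges G"
    by (auto simp: induced_def)
  ultimately show ?thesis
    using assms unfolding labelled_iff by (meson image_mono inj_on_subset subset_iff subset_trans)
qed

lemma graph_class_subdivided: "graph_class (subdivided_class \<epsilon>)"
  unfolding graph_class_def
proof (intro conjI ballI allI impI)
  fix G assume "G \<in> subdivided_class \<epsilon>"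
  then obtain g m L f where G: "1 \<le> m" "real m powr \<epsilon> \<le> real L powr (1 - \<epsilon>)" "labelled G g 48 m L f"
    by (rule subdivided_classE)
  then show "simple_graph G" by (simp add: labelled_iff)
  fix H :: "nat ugraph" assume "simple_graph H \<and> graph_iso G H"
  then obtain g' where "labelled H g' 48 m L f" using labelled_iso[OF G(3)] by blast
  with G(1,2) show "H \<in> subdivided_class \<epsilon>" by (rule subdivided_classI)
qed

lemma hereditary_subdivided: "hereditary (subdivided_class \<epsilon>)"
  unfolding hereditary_def
proof (intro ballI allI impI)
  fix G X assume "G \<in> subdivided_class \<epsilon>"
  then obtain g m L f where G: "1 \<le> m" "real m powr \<epsilon> \<le> real L powr (1 - \<epsilon>)" "labelled G g 48 m L f"
    by (rule subdivided_classE)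
  from G(1,2) labelled_induced[OF G(3)] show "induced G X \<in> subdivided_class \<epsilon>"
    by (rule subdivided_classI)
qed

section \<open>Growth of the separator function\<close>

lemma sep_number_subdivided_le:
  assumes \<epsilon>: "0 < \<epsilon>" "\<epsilon> \<le> 1" and G: "G \<in> subdivided_class \<epsilon>"
  shows "real (sep_number G) \<le> 3 * real (card (verts G)) powr (1 - \<epsilon>)"
proof -
  obtain g m L f where m: "1 \<le> m" "real m powr \<epsilon> \<le> real L powr (1 - \<epsilon>)" and "labelled G g 48 m L f"
    using G by (rule subdivided_classE)
  then interpret labelled G g 48 m L f by simp
  let ?k = "card (verts G)"
  obtain c where c: "c * L \<le> ?k" "sep_number G \<le> c + 2" using sep_number_le_levels by blast
  show ?thesis
  proof (cases "?k = 0")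
    case True
    then show ?thesis using sep_number_le[OF simple balanced_separator_verts] by simp
  next
    case False
    \<comment> \<open>Absorbs the additive 2 of the separator bounds into the factor 3.\<close>
    have k1: "1 \<le> real ?k powr (1 - \<epsilon>)" using False \<epsilon> by (intro ge_one_powr_ge_zero) auto
    \<comment> \<open>The minimum is at most the weighted geometric mean of \<open>m\<close> and
      \<open>c\<close> with weights \<open>\<epsilon>\<close> and \<open>1 - \<epsilon>\<close>; the
      class condition replaces the power of \<open>m\<close> by one of \<open>L\<close>.\<close>
    define a where "a = min m c"
    have "real a \<le> real ?k powr (1 - \<epsilon>)"
    proof (cases "a = 0")
      case True
      then show ?thesis by simp
    next
      case False
      have "real a = real a powr \<epsilon> * real a powr (1 - \<epsilon>)"
        using False by (simp flip: powr_add)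
      also have "\<dots> \<le> real m powr \<epsilon> * real c powr (1 - \<epsilon>)"
        using \<epsilon> by (intro mult_mono powr_mono2) (auto simp: a_def)
      also have "\<dots> \<le> real L powr (1 - \<epsilon>) * real c powr (1 - \<epsilon>)"
        using m(2) by (intro mult_right_mono) auto
      also have "\<dots> = real (c * L) powr (1 - \<epsilon>)" by (simp add: powr_mult mult.commute)
      also have "\<dots> \<le> real ?k powr (1 - \<epsilon>)"
        using c(1) \<epsilon> by (intro powr_mono2) (auto simp del: of_nat_mult)
      finally show ?thesis .
    qed
    moreover have "sep_number G \<le> a + 2" using c(2) sep_number_le_hubs by (auto simp: a_def)
    ultimately show ?thesis using k1 by linarith
  qed
qed

text \<open>A supremum of naturals is meaningful only for bounded sets; this is the common bound,
  rounded to \<open>nat\<close>.\<close>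

lemma sep_number_subdivided_le_nat:
  assumes "0 < \<epsilon>" "\<epsilon> \<le> 1" "G \<in> subdivided_class \<epsilon>" "card (verts G) \<le> n"
  shows "sep_number G \<le> nat \<lfloor>3 * real n powr (1 - \<epsilon>)\<rfloor>"
proof -
  have "real (card (verts G)) powr (1 - \<epsilon>) \<le> real n powr (1 - \<epsilon>)"
    using assms by (intro powr_mono2) auto
  then have "real (sep_number G) \<le> 3 * real n powr (1 - \<epsilon>)"
    using sep_number_subdivided_le[OF assms(1-3)] by linarith
  then show ?thesis by (simp add: le_nat_floor)
qed

lemma sep_fun_subdivided_le:
  assumes "0 < \<epsilon>" "\<epsilon> \<le> 1"
  shows "real (sep_fun (subdivided_class \<epsilon>) n) \<le> 3 * real n powr (1 - \<epsilon>)"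
proof -
  let ?A = "{G \<in> subdivided_class \<epsilon>. card (verts G) \<le> n}"
  have "sep_fun (subdivided_class \<epsilon>) n \<le> nat \<lfloor>3 * real n powr (1 - \<epsilon>)\<rfloor>"
  proof (cases "?A = {}")
    case True
    then show ?thesis unfolding sep_fun_def by (simp only: image_empty) simp
  next
    case False
    then show ?thesis
      unfolding sep_fun_def using sep_number_subdivided_le_nat[OF assms] by (intro cSUP_least) auto
  qed
  then show ?thesis
    by (smt (verit) of_nat_floor of_nat_le_iff powr_ge_zero zero_le_mult_iff)
qed

lemma le_sep_fun_subdivided:
  assumes "0 < \<epsilon>" "\<epsilon> \<le> 1" "G \<in> subdivided_class \<epsilon>" "card (verts G) \<le> n"
  shows "sep_number G \<le> sep_fun (subdivided_class \<epsilon>) n"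
  unfolding sep_fun_def using assms sep_number_subdivided_le_nat[OF assms(1,2)]
  by (intro cSUP_upper bdd_aboveI2) auto

lemma labelled_relabel_subdivision:
  assumes "L \<ge> 1" "f \<in> {..<m} \<times> {..<d} \<rightarrow> {..<m}"
  shows "labelled (relabel (to_nat :: label \<Rightarrow> nat) (subdivision d m L f)) from_nat d m L f"
  using assms simple_graph_relabel[OF inj_to_nat simple_graph_subdivision[OF assms]]
  by (auto simp: labelled_iff relabel_def inj_on_def image_comp)

text \<open>The one-vertex graph suffices. This covers small \<open>n\<close> and the rounding of
  \<open>m\<close> in the next bound.\<close>

lemma sep_fun_subdivided_ge_one:
  assumes "0 < \<epsilon>" "\<epsilon> \<le> 1" "n \<ge> 1"
  shows "1 \<le> sep_fun (subdivided_class \<epsilon>) n"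
proof -
  let ?G = "\<lparr>verts = {0::nat}, edges = {}\<rparr>"
  have simple: "simple_graph ?G" by (simp add: simple_graph_def)
  have "labelled ?G (\<lambda>_. Hub 0) 48 1 1 (\<lambda>_. 0)"
    using simple by (simp add: labelled_iff subdivision_def)
  then have "?G \<in> subdivided_class \<epsilon>"
    by (intro subdivided_classI) auto
  then have "sep_number ?G \<le> sep_fun (subdivided_class \<epsilon>) n"
    using assms by (intro le_sep_fun_subdivided) auto
  moreover have "1 \<le> sep_number ?G"
  proof (rule le_sep_number[OF simple])
    fix X assume X: "balanced_separator ?G X"
    have "comp_of ?G {} 0 = {0}" by (auto simp: comp_of_def)
    then have "X \<noteq> {}" using X by (auto simp: balanced_separator_iff)
    moreover have "X \<subseteq> {0}" using X by (simp add: balanced_separator_iff)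
    ultimately have "X = {0}" by blast
    then show "1 \<le> card X" by simp
  qed
  ultimately show ?thesis by simp
qed

lemma sep_fun_subdivided_ge:
  assumes \<epsilon>: "0 < \<epsilon>" "\<epsilon> \<le> 1" and n: "n \<ge> 1"
  shows "real n powr (1 - \<epsilon>) \<le> 1274 * real (sep_fun (subdivided_class \<epsilon>) n)"
proof -
  \<comment> \<open>The subdivision has \<open>m * (48 * L + 1)\<close> vertices, at most
    \<open>49 * m * L\<close>, and rounding up costs \<open>L\<close> a factor of at most 2;
    dividing by \<open>98 = 49 * 2\<close> keeps the size below \<open>n\<close>.\<close>
  define x where "x = real n powr (1 - \<epsilon>) / 98"
  define m where "m = nat \<lfloor>x\<rfloor>"
  define L where "L = nat \<lceil>real n powr \<epsilon>\<rceil>"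
  let ?s = "sep_fun (subdivided_class \<epsilon>) n"
  have x0: "x \<ge> 0" by (simp add: x_def)
  have mx: "real m \<le> x" using x0 by (simp add: m_def)
  have n1: "1 \<le> real n powr \<epsilon>" using n \<epsilon> by (intro ge_one_powr_ge_zero) auto
  then have L: "real n powr \<epsilon> \<le> real L" "real L \<le> 2 * real n powr \<epsilon>"
    unfolding L_def by linarith+
  then have L1: "L \<ge> 1" using n1 by linarith
  have "m \<le> 12 * ?s"
  proof (cases "m \<ge> 1")
    case False
    then show ?thesis by simp
  next
    case True
    obtain f where f: "f \<in> {..<m} \<times> {..<48} \<rightarrow> {..<m}" "expanding m f" using ex_expanding[OF True] .
    let ?G = "relabel (to_nat :: label \<Rightarrow> nat) (subdivision 48 m L f)"
    have lab: "labelled ?G from_nat 48 m L f" using labelled_relabel_subdivision[OF L1 f(1)] .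
    have "real m powr \<epsilon> \<le> (real n powr (1 - \<epsilon>)) powr \<epsilon>"
      using mx \<epsilon> by (intro powr_mono2) (auto simp: x_def)
    also have "\<dots> = (real n powr \<epsilon>) powr (1 - \<epsilon>)" by (simp add: powr_powr mult.commute)
    also have "\<dots> \<le> real L powr (1 - \<epsilon>)" using L \<epsilon> by (intro powr_mono2) auto
    finally have G: "?G \<in> subdivided_class \<epsilon>" using True lab by (intro subdivided_classI)
    have "real m * real L \<le> x * (2 * real n powr \<epsilon>)"
      using mx L x0 by (intro mult_mono) auto
    also have "\<dots> = 2 * (real n powr (1 - \<epsilon>) * real n powr \<epsilon>) / 98" by (simp add: x_def)
    also have "real n powr (1 - \<epsilon>) * real n powr \<epsilon> = real n" using n by (simp flip: powr_add)
    finally have "49 * (m * L) \<le> n" by (simp flip: of_nat_mult)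
    moreover have "m \<le> m * L" using L1 by simp
    ultimately have "m * (48 * L + 1) \<le> n" unfolding distrib_left by linarith
    moreover have "card (verts ?G) = m * (48 * L + 1)"
      using card_image[OF inj_on_subset[OF inj_to_nat subset_UNIV], of "verts (subdivision 48 m L f)"]
        card_verts_subdivision
      by (simp add: relabel_def)
    ultimately have "card (verts ?G) \<le> n" by simp
    then have "sep_number ?G \<le> ?s" using le_sep_fun_subdivided[OF \<epsilon> G] by simp
    \<comment> \<open>This is \<open>m / 12\<close> rounded up.\<close>
    moreover have "(m + 11) div 12 \<le> sep_number ?G"
    proof (rule le_sep_number)
      show "simple_graph ?G" using lab by (simp add: labelled_iff)
      fix X assume "balanced_separator ?G X"
      from balanced_separator_expanding[OF inj_to_nat L1 f this]
      show "(m + 11) div 12 \<le> card X" by linarith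
    qed
    ultimately show ?thesis by linarith
  qed
  moreover have "x - 1 \<le> real m" unfolding m_def using x0 by linarith
  moreover have "1 \<le> ?s" using sep_fun_subdivided_ge_one[OF \<epsilon> n] .
  \<comment> \<open>Twelve from the expander bound and one from rounding \<open>x\<close> down;
    \<open>98 * 13 = 1274\<close>.\<close>
  ultimately have "x \<le> 13 * real ?s" by linarith
  then show ?thesis by (simp add: x_def)
qed

lemma sep_fun_subdivided_bigtheta:
  assumes "0 < \<epsilon>" "\<epsilon> \<le> 1"
  shows "(\<lambda>n. real (sep_fun (subdivided_class \<epsilon>) n)) \<in> \<Theta>(\<lambda>n. real n powr (1 - \<epsilon>))"
proof (rule bigthetaI)
  show "(\<lambda>n. real (sep_fun (subdivided_class \<epsilon>) n)) \<in> O(\<lambda>n. real n powr (1 - \<epsilon>))"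
    using sep_fun_subdivided_le[OF assms] by (intro bigoI[of _ 3]) auto
  show "(\<lambda>n. real (sep_fun (subdivided_class \<epsilon>) n)) \<in> \<Omega>(\<lambda>n. real n powr (1 - \<epsilon>))"
    unfolding bigomega_iff_bigo
    using sep_fun_subdivided_ge[OF assms]
    by (intro bigoI[of _ 1274] eventually_sequentiallyI[of 1]) auto
qed

section \<open>Density of the class and the bound on the exponent\<close>

lemma nabla_fun_subdivided_le:
  assumes \<epsilon>: "0 < \<epsilon>" "\<epsilon> \<le> 1" and r: "r \<ge> 1"
  defines "\<beta> \<equiv> 1 / (2 * \<epsilon>) - 1 / 2"
  shows "nabla_fun (subdivided_class \<epsilon>) r \<le> ereal ((50 + 7 * 2 powr \<beta>) * real r powr \<beta>)"
  unfolding nabla_fun_def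
proof (rule SUP_least)
  fix G assume "G \<in> subdivided_class \<epsilon>"
  then obtain g m L f where m: "1 \<le> m" "real m powr \<epsilon> \<le> real L powr (1 - \<epsilon>)"
    and "labelled G g 48 m L f" by (rule subdivided_classE)
  then interpret labelled G g 48 m L f by simp
  have \<beta>: "\<beta> = (1 - \<epsilon>) / (2 * \<epsilon>)" using \<epsilon> by (simp add: \<beta>_def field_simps)
  then have \<beta>0: "\<beta> \<ge> 0" using \<epsilon> by simp
  have r1: "1 \<le> real r powr \<beta>" using r \<beta>0 by (intro ge_one_powr_ge_zero) auto
  have "nabla r G \<le> (50 + 7 * 2 powr \<beta>) * real r powr \<beta>"
  \<comment> \<open>Long routes give the constant \<open>50 = 2 + 48\<close>. Short ones have
    \<open>L < 2 * r\<close>, which brings in \<open>2 powr \<beta>\<close>, and 7 bounds the square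
    root of 48.\<close>
  proof (cases "2 * r \<le> L")
    case True
    have "nabla r G \<le> 50" using nabla_le_degree[OF True] by simp
    also have "\<dots> \<le> 50 * real r powr \<beta>" using r1 by simp
    also have "\<dots> \<le> (50 + 7 * 2 powr \<beta>) * real r powr \<beta>" by (intro mult_right_mono) auto
    finally show ?thesis .
  next
    case False
    have "sqrt (real m) = real m powr (1 / 2)" using m(1) by (simp add: powr_half_sqrt)
    also have "\<dots> = (real m powr \<epsilon>) powr (1 / (2 * \<epsilon>))" using \<epsilon> by (simp add: powr_powr)
    also have "\<dots> \<le> (real L powr (1 - \<epsilon>)) powr (1 / (2 * \<epsilon>))"
      using \<epsilon> m(2) by (intro powr_mono2) auto
    also have "\<dots> = real L powr \<beta>" by (simp add: powr_powr \<beta>)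
    also have "\<dots> \<le> (2 * real r) powr \<beta>" using False \<beta>0 by (intro powr_mono2) auto
    finally have sm: "sqrt (real m) \<le> 2 powr \<beta> * real r powr \<beta>" by (simp add: powr_mult)
    have "sqrt 48 \<le> (7::real)" by (rule real_le_lsqrt) auto
    then have "sqrt (real (48 * m)) \<le> 7 * sqrt (real m)"
      by (simp add: real_sqrt_mult mult_right_mono)
    then have "nabla r G \<le> 2 + 7 * (2 powr \<beta> * real r powr \<beta>)" using nabla_le_hubs[of r] sm by linarith
    then show ?thesis using r1 by (simp add: algebra_simps)
  qed
  then show "ereal (nabla r G) \<le> ereal ((50 + 7 * 2 powr \<beta>) * real r powr \<beta>)" by simp
qed

theorem lemma10:
  fixes \<epsilon> :: real
  assumes "0 < \<epsilon>" and "\<epsilon> \<le> 1"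
  shows "b_sup \<epsilon> \<le> ereal (1 / (2 * \<epsilon>) - 1 / 2)"
  unfolding b_sup_def
proof (rule SUP_least)
  let ?\<G> = "subdivided_class \<epsilon>"
  define \<beta> where "\<beta> = 1 / (2 * \<epsilon>) - 1 / 2"
  define C where "C = 50 + 7 * 2 powr \<beta>"
  fix b assume "b \<in> {b. \<forall>\<G>. graph_class \<G> \<and> hereditary \<G> \<and>
      (\<lambda>n. real (sep_fun \<G> n)) \<in> \<Theta>(\<lambda>n. real n powr (1 - \<epsilon>)) \<longrightarrow> omega_powr (nabla_fun \<G>) b}"
  then have "omega_powr (nabla_fun ?\<G>) b"
    using graph_class_subdivided hereditary_subdivided sep_fun_subdivided_bigtheta[OF assms] by blast
  then obtain c where c: "c > 0" "\<forall>\<^sub>F r in sequentially. ereal (c * real r powr b) \<le> nabla_fun ?\<G> r"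
    by (auto simp: omega_powr_def)
  have "b \<le> \<beta>"
  proof (rule ccontr)
    assume "\<not> b \<le> \<beta>"
    \<comment> \<open>If \<open>b\<close> exceeded \<open>\<beta>\<close>, the upper bound
      \<open>C * r powr \<beta>\<close> divided by \<open>r powr b\<close> would tend to 0 and fall
      below the constant \<open>c\<close>.\<close>
    then have "(\<lambda>r. real r powr (\<beta> - b)) \<longlonglongrightarrow> 0"
      by (intro tendsto_neg_powr filterlim_real_sequentially) simp
    then have "(\<lambda>r. C * real r powr (\<beta> - b)) \<longlonglongrightarrow> 0"
      by (rule tendsto_mult_right_zero)
    then have "\<forall>\<^sub>F r in sequentially. C * real r powr (\<beta> - b) < c"
      using c(1) by (rule order_tendstoD)
    with c(2) eventually_ge_at_top[of 1] have "\<forall>\<^sub>F r in sequentially. False"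
    proof eventually_elim
      case (elim r)
      have "ereal (c * real r powr b) \<le> ereal (C * real r powr \<beta>)"
        using elim(1) nabla_fun_subdivided_le[OF assms elim(2)] unfolding C_def \<beta>_def
        by (rule order_trans)
      then have "c * real r powr b \<le> C * real r powr \<beta>" by simp
      moreover have "real r powr \<beta> = real r powr (\<beta> - b) * real r powr b" by (simp flip: powr_add)
      moreover have "real r powr b > 0" using elim(2) by simp
      ultimately have "c \<le> C * real r powr (\<beta> - b)" by (simp add: mult.assoc[symmetric])
      then show False using elim(3) by simp
    qed
    then show False by simp
  qed
  then show "ereal b \<le> ereal (1 / (2 * \<epsilon>) - 1 / 2)" by (simp add: \<beta>_def)
qed

end
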